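(* Let $R\in\mathbb{R}$ and assume $V_{\mathbf 0}\ne\{0\}$. (i) One has $\exp(v)\in\widehat{\mathcal{W}}_R(V)$ for every non-zero $v\in V$ if and only if $R<1$. (ii) Let $R<1$ and $v\in V$. The map $\mathbb{K}\ni t\mapsto\exp(tv)\in\widehat{\mathcal{W}}_R(V)$ is real-analytic with radius of convergence $\infty$ in the case $\mathbb{K}=\mathbb{R}$, and entire in the case $\mathbb{K}=\mathbb{C}$. The Taylor series converges absolutely.
   Context: $\mathbb{K}=\mathbb{R}$ or $\mathbb{C}$, and $V=V_{\mathbf 0}\oplus V_{\mathbf 1}$ is a $\mathbb{Z}_2$-graded Hausdorff locally convex $\mathbb{K}$-vector space such that the projections onto $V_{\mathbf 0}$ and $V_{\mathbf 1}$ are continuous. $S_n$ acts from the right on $V^{\otimes n}$ by $(v_1\otimes\cdots\otimes v_n)\triangleleft\sigma=\pm\, v_{\sigma(1)}\otimes\cdots\otimes v_{\sigma(n)}$ for homogeneous $v_i$, where $\pm$ is the Koszul sign ($-1$ to the number of pairs $i<j$ with $\sigma(i)>\sigma(j)$ and $v_{\sigma(i)},v_{\sigma(j)}$ both odd). $\mathcal{S}_n(v)=\frac1{n!}\sum_{\sigma} v\triangleleft\sigma$, $\mathrm{S}^n(V)=\operatorname{im}\mathcal{S}_n\subseteq V^{\otimes n}$, $\mathrm{S}^0(V)=\mathbb{K}$, $\mathrm{S}^\bullet(V)=\bigoplus_n\mathrm{S}^n(V)$, with product $vw=\mathcal{S}(v\otimes w)$, $\mathcal{S}=\bigoplus_n\mathcal{S}_n$.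 For a continuous seminorm $p$ on $V$ let $p^n=p\otimes\cdots\otimes p$ be the projective tensor seminorm on $V^{\otimes n}$ ($p^0=|\cdot|$), also on completions, and $p_R(v)=\sum_{n\ge0}p^n(v_n)\,n!^R\in[0,\infty]$ for $v=\sum_nv_n$. $\mathcal{W}_R(V)$ is (as a locally convex space) $\mathrm{S}^\bullet(V)$ with the topology of all $p_R$, $p$ a continuous seminorm on $V$. Its completion $\widehat{\mathcal{W}}_R(V)$ consists of the formal series $v=\sum_{n\ge0}v_n$ with $v_n$ in the completion of $\mathrm{S}^n(V)$ (projective topology) and $p_R(v)<\infty$ for all continuous seminorms $p$ on $V$. $\exp(v)=\sum_{n=0}^\infty\frac{v^n}{n!}$ is the formal series with powers taken in $\mathrm{S}^\bullet(V)$ (symmetric tensor product). *)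

theory Defs
  imports
    "HOL-Analysis.Analysis"
    "HOL-Library.Function_Algebras"
    "HOL-Combinatorics.Permutations"
begin

section \<open>Hausdorff completion of a space topologised by seminorms\<close>

text \<open>
  \<^term>\<open>E\<close> is a subspace of an ambient additive group and \<^term>\<open>Q\<close> a family of seminorms on it.
  A point of the completion is an equivalence class of Cauchy filters on \<^term>\<open>E\<close>; the vector space
  operations and the seminorms are those of \<^term>\<open>E\<close>, extended by continuity.
\<close>

definition cauchy_filters :: "'e::ab_group_add set \<Rightarrow> ('e \<Rightarrow> real) set \<Rightarrow> 'e filter set" where
  "cauchy_filters E Q = {F. F \<noteq> bot \<and> (\<forall>\<^sub>F x in F. x \<in> E) \<and>
     (\<forall>q\<in>Q. \<forall>e>0. \<forall>\<^sub>F z in F \<times>\<^sub>F F. q (fst z - snd z) < e)}"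

definition cauchy_equiv :: "'e::ab_group_add set \<Rightarrow> ('e \<Rightarrow> real) set \<Rightarrow> 'e filter rel" where
  "cauchy_equiv E Q = {(F, G). F \<in> cauchy_filters E Q \<and> G \<in> cauchy_filters E Q \<and>
     (\<forall>q\<in>Q. \<forall>e>0. \<forall>\<^sub>F z in F \<times>\<^sub>F G. q (fst z - snd z) < e)}"

definition completion :: "'e::ab_group_add set \<Rightarrow> ('e \<Rightarrow> real) set \<Rightarrow> 'e filter set set" where
  "completion E Q = cauchy_filters E Q // cauchy_equiv E Q"

definition completion_embed ::
    "'e::ab_group_add set \<Rightarrow> ('e \<Rightarrow> real) set \<Rightarrow> 'e \<Rightarrow> 'e filter set" where
  "completion_embed E Q x = cauchy_equiv E Q `` {principal {x}}"

definition completion_add ::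
    "'e::ab_group_add set \<Rightarrow> ('e \<Rightarrow> real) set \<Rightarrow> 'e filter set \<Rightarrow> 'e filter set \<Rightarrow> 'e filter set" where
  "completion_add E Q X Y =
     (\<Union>F\<in>X. \<Union>G\<in>Y. cauchy_equiv E Q `` {filtermap (\<lambda>z. fst z + snd z) (F \<times>\<^sub>F G)})"

definition completion_map ::
    "'e::ab_group_add set \<Rightarrow> ('e \<Rightarrow> real) set \<Rightarrow> ('e \<Rightarrow> 'e) \<Rightarrow> 'e filter set \<Rightarrow> 'e filter set" where
  "completion_map E Q g X = (\<Union>F\<in>X. cauchy_equiv E Q `` {filtermap g F})"

definition completion_seminorm :: "('e \<Rightarrow> real) \<Rightarrow> 'e filter set \<Rightarrow> real" where
  "completion_seminorm q X = (THE r. \<forall>F\<in>X. (q \<longlongrightarrow> r) F)"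


lemma eventually_principal_prod:
  "(\<forall>\<^sub>F z in principal {x} \<times>\<^sub>F principal {y}. P z) \<longleftrightarrow> P (x, y)"
  by (simp add: principal_prod_principal eventually_principal)

lemma eventually_principal_prod_left:
  "(\<forall>\<^sub>F z in principal {y} \<times>\<^sub>F F. P z) \<longleftrightarrow> (\<forall>\<^sub>F x in F. P (y, x))"
proof
  assume "\<forall>\<^sub>F z in principal {y} \<times>\<^sub>F F. P z"
  then obtain A B where "eventually A (principal {y})" "eventually B F" "\<And>a b. A a \<Longrightarrow> B b \<Longrightarrow> P (a, b)"
    unfolding eventually_prod_filter by blast
  then show "\<forall>\<^sub>F x in F. P (y, x)"
    by (metis (mono_tags, lifting) eventually_mono eventually_principal singletonI)
next
  assume "\<forall>\<^sub>F x in F. P (y, x)"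
  then show "\<forall>\<^sub>F z in principal {y} \<times>\<^sub>F F. P z"
    unfolding eventually_prod_filter
    by (intro exI[of _ "\<lambda>a. a = y"] exI[of _ "\<lambda>b. P (y, b)"]) (simp add: eventually_principal)
qed

lemma mem_completion_embed:
  assumes "x \<in> E" "\<And>q. q \<in> Q \<Longrightarrow> q 0 = 0"
  shows "F \<in> completion_embed E Q x \<longleftrightarrow>
    F \<in> cauchy_filters E Q \<and> (\<forall>q\<in>Q. \<forall>e>0. \<forall>\<^sub>F y in F. q (x - y) < e)"
proof -
  have "principal {x} \<in> cauchy_filters E Q"
    using assms by (simp add: cauchy_filters_def eventually_principal eventually_principal_prod principal_eq_bot_iff) metis
  then show ?thesis
    by (auto simp: completion_embed_def cauchy_equiv_def eventually_principal_prod_left)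
qed

lemma completion_seminorm_embed:
  assumes "x \<in> E" "q \<in> Q" and Q0: "\<And>q. q \<in> Q \<Longrightarrow> q 0 = 0"
    and tri: "\<And>q y. q \<in> Q \<Longrightarrow> y \<in> E \<Longrightarrow> \<bar>q x - q y\<bar> \<le> q (x - y)"
  shows "completion_seminorm q (completion_embed E Q x) = q x"
proof -
  have in_emb: "principal {x} \<in> completion_embed E Q x"
    using \<open>x \<in> E\<close> Q0 by (simp add: mem_completion_embed cauchy_filters_def eventually_principal
      eventually_principal_prod principal_eq_bot_iff) metis
  have lim: "(q \<longlongrightarrow> q x) F" if "F \<in> completion_embed E Q x" for F
  proof (rule tendstoI)
    fix e :: real assume "e > 0"
    have F: "F \<in> cauchy_filters E Q" "\<forall>\<^sub>F y in F. q (x - y) < e"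
      using that assms \<open>e > 0\<close> by (auto simp: mem_completion_embed)
    have "\<forall>\<^sub>F y in F. y \<in> E" using F by (auto simp: cauchy_filters_def)
    with F(2) show "\<forall>\<^sub>F y in F. dist (q y) (q x) < e"
      by eventually_elim (use tri assms in \<open>fastforce simp: dist_real_def abs_minus_commute\<close>)
  qed
  show ?thesis unfolding completion_seminorm_def
  proof (rule the_equality)
    fix r assume "\<forall>F\<in>completion_embed E Q x. (q \<longlongrightarrow> r) F"
    then have "(q \<longlongrightarrow> r) (principal {x})" using in_emb by blast
    then show "r = q x"
      by (metis in_emb lim tendsto_unique principal_eq_bot_iff insert_not_empty)
  qed (use lim in blast)
qed

section \<open>Graded locally convex spaces\<close>

locale graded_lcs = vector_space scale
  for scale :: "'k::real_normed_field \<Rightarrow> 'v::{t2_space, topological_ab_group_add} \<Rightarrow> 'v" +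
  fixes V0 V1 :: "'v set"
  assumes continuous_scale: "continuous_on UNIV (\<lambda>z. scale (fst z) (snd z))"
    and locally_convex: "open U \<Longrightarrow> 0 \<in> U \<Longrightarrow> \<exists>W. open W \<and> 0 \<in> W \<and> W \<subseteq> U \<and>
      (\<forall>x\<in>W. \<forall>y\<in>W. \<forall>s\<in>{0..1}. scale (of_real s) x + scale (of_real (1 - s)) y \<in> W)"
    and subspace_V0: "subspace V0"
    and subspace_V1: "subspace V1"
    and disjoint: "V0 \<inter> V1 = {0}"
    and sum_UNIV: "\<exists>x\<in>V0. \<exists>y\<in>V1. v = x + y"
    and continuous_even: "continuous_on UNIV (\<lambda>v. THE x. x \<in> V0 \<and> v - x \<in> V1)"
    and continuous_odd: "continuous_on UNIV (\<lambda>v. THE y. y \<in> V1 \<and> v - y \<in> V0)"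
begin

definition even_part :: "'v \<Rightarrow> 'v" where
  "even_part v = (THE x. x \<in> V0 \<and> v - x \<in> V1)"

definition odd_part :: "'v \<Rightarrow> 'v" where
  "odd_part v = (THE y. y \<in> V1 \<and> v - y \<in> V0)"

definition part :: "bool \<Rightarrow> 'v \<Rightarrow> 'v" where
  "part b v = (if b then odd_part v else even_part v)"

definition continuous_seminorm :: "('v \<Rightarrow> real) \<Rightarrow> bool" where
  "continuous_seminorm p \<longleftrightarrow> continuous_on UNIV p \<and>
     (\<forall>x y. p (x + y) \<le> p x + p y) \<and> (\<forall>c x. p (scale c x) = norm c * p x)"

end


section \<open>Tensor powers\<close>

text \<open>
  The algebraic tensor power \<open>V\<^sup>\<otimes>\<^sup>n\<close> is realised inside the dual of the space of all (not
  necessarily continuous) \<^term>\<open>n\<close>-linear forms on \<open>V\<close>: the elementary tensor of a list of vectors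
  is the evaluation at that list. Elements of \<open>V\<^sup>n\<close> are lists of length \<^term>\<open>n\<close>, counted from 0,
  and \<^term>\<open>n\<close>-linear forms are functions on lists whose values off length \<^term>\<open>n\<close> are irrelevant.
  Elementary tensors are set to 0 on functions that are not multilinear.
\<close>

type_synonym ('v, 'k) tensor = "('v list \<Rightarrow> 'k) \<Rightarrow> 'k"

definition tensor_scale :: "'k \<Rightarrow> ('v, 'k) tensor \<Rightarrow> ('v, 'k::field) tensor" where
  "tensor_scale c x = (\<lambda>f. c * x f)"

global_interpretation tensor: vector_space tensor_scale
  by standard (auto simp: tensor_scale_def fun_eq_iff algebra_simps)

context graded_lcs
begin

definition multilinear :: "nat \<Rightarrow> ('v list \<Rightarrow> 'k) \<Rightarrow> bool" where
  "multilinear n f \<longleftrightarrow> (\<forall>vs i. length vs = n \<longrightarrow> i < n \<longrightarrow>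
     Vector_Spaces.linear scale (*) (\<lambda>x. f (vs[i := x])))"

definition elem_tensor :: "'v list \<Rightarrow> ('v, 'k) tensor" where
  "elem_tensor vs = (\<lambda>f. if multilinear (length vs) f then f vs else 0)"

definition tensor_power :: "nat \<Rightarrow> ('v, 'k) tensor set" where
  "tensor_power n = tensor.span (elem_tensor ` {vs. length vs = n})"

definition tensor_mult :: "nat \<Rightarrow> nat \<Rightarrow> ('v, 'k) tensor \<Rightarrow> ('v, 'k) tensor \<Rightarrow> ('v, 'k) tensor" where
  "tensor_mult m n x y =
     (\<lambda>f. if multilinear (m + n) f then x (\<lambda>vs. y (\<lambda>ws. f (vs @ ws))) else 0)"

text \<open>The projective seminorm, as an infimum over all representations by elementary tensors.\<close>

definition proj_seminorm :: "('v \<Rightarrow> real) \<Rightarrow> nat \<Rightarrow> ('v, 'k) tensor \<Rightarrow> real" where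
  "proj_seminorm p n x =
     Inf {\<Sum>(c, vs)\<leftarrow>zs. norm c * prod_list (map p vs) | zs.
            (\<forall>(c, vs)\<in>set zs. length vs = n) \<and>
            x = (\<Sum>(c, vs)\<leftarrow>zs. tensor_scale c (elem_tensor vs))}"


section \<open>The graded action of the symmetric group and symmetric powers\<close>

text \<open>\<^term>\<open>od j\<close> tells whether the \<^term>\<open>j\<close>-th vector is odd.\<close>

definition koszul_sign :: "nat \<Rightarrow> (nat \<Rightarrow> nat) \<Rightarrow> (nat \<Rightarrow> bool) \<Rightarrow> 'k" where
  "koszul_sign n \<sigma> od =
     (-1) ^ card {(i, j). i < j \<and> j < n \<and> \<sigma> i > \<sigma> j \<and> od (\<sigma> i) \<and> od (\<sigma> j)}"

text \<open>
  \<open>(v\<^sub>0 \<otimes> \<dots> \<otimes> v\<^sub>n\<^sub>-\<^sub>1) \<triangleleft> \<sigma>\<close> for not necessarily homogeneous vectors, by expansion into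
  homogeneous components, followed by its linear extension to the tensor power.
\<close>

definition perm_elem :: "nat \<Rightarrow> (nat \<Rightarrow> nat) \<Rightarrow> 'v list \<Rightarrow> ('v, 'k) tensor" where
  "perm_elem n \<sigma> vs = (\<Sum>e | length e = n.
     tensor_scale (koszul_sign n \<sigma> (\<lambda>j. e ! j))
       (elem_tensor (map (\<lambda>i. part (e ! \<sigma> i) (vs ! \<sigma> i)) [0..<n])))"

definition perm_act :: "nat \<Rightarrow> (nat \<Rightarrow> nat) \<Rightarrow> ('v, 'k) tensor \<Rightarrow> ('v, 'k) tensor" where
  "perm_act n \<sigma> x = (\<lambda>f. x (\<lambda>vs. perm_elem n \<sigma> vs f))"

definition symmetrize :: "nat \<Rightarrow> ('v, 'k) tensor \<Rightarrow> ('v, 'k) tensor" where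
  "symmetrize n x = tensor_scale (1 / fact n) (\<Sum>\<sigma> | \<sigma> permutes {..<n}. perm_act n \<sigma> x)"

definition sym_power :: "nat \<Rightarrow> ('v, 'k) tensor set" where
  "sym_power n = symmetrize n ` tensor_power n"

definition sym_mult :: "nat \<Rightarrow> nat \<Rightarrow> ('v, 'k) tensor \<Rightarrow> ('v, 'k) tensor \<Rightarrow> ('v, 'k) tensor" where
  "sym_mult m n x y = symmetrize (m + n) (tensor_mult m n x y)"

text \<open>\<^term>\<open>vpow v n\<close> is the power \<open>v\<^sup>n\<close> in the symmetric algebra; it lies in degree \<^term>\<open>n\<close>.\<close>

primrec vpow :: "'v \<Rightarrow> nat \<Rightarrow> ('v, 'k) tensor" where
  "vpow v 0 = elem_tensor []"
| "vpow v (Suc n) = sym_mult n 1 (vpow v n) (elem_tensor [v])"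


text \<open>
  The next facts lead to \<open>perm_elem_homogeneous\<close> and \<open>perm_act_elem\<close>, which together say that
  \<^term>\<open>perm_act\<close> is the Koszul action on homogeneous elementary tensors, and to
  \<open>tensor_mult_elem\<close>, the concatenation of elementary tensors.
\<close>


lemma decompose:
  assumes "x \<in> V0" "y \<in> V1" shows "even_part (x + y) = x" "odd_part (x + y) = y"
proof -
  have D: "z = 0" if "z \<in> V0" "z \<in> V1" for z using that disjoint by auto
  show "even_part (x + y) = x" unfolding even_part_def
  proof (rule the_equality)
    fix z assume z: "z \<in> V0 \<and> x + y - z \<in> V1"
    then have "x + y - z - y \<in> V1" using assms subspace_diff[OF subspace_V1] by blast
    then have "x - z \<in> V1" by (simp add: algebra_simps)
    moreover have "x - z \<in> V0" using assms z subspace_diff[OF subspace_V0] by blast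
    ultimately show "z = x" using D by force
  qed (use assms in auto)
  show "odd_part (x + y) = y" unfolding odd_part_def
  proof (rule the_equality)
    fix z assume z: "z \<in> V1 \<and> x + y - z \<in> V0"
    then have "x + y - z - x \<in> V0" using assms subspace_diff[OF subspace_V0] by blast
    then have "y - z \<in> V0" by (simp add: algebra_simps)
    moreover have "y - z \<in> V1" using assms z subspace_diff[OF subspace_V1] by blast
    ultimately show "z = y" using D by force
  qed (use assms in auto)
qed

lemma even_part_V0: "v \<in> V0 \<Longrightarrow> even_part v = v" and even_part_V1: "v \<in> V1 \<Longrightarrow> even_part v = 0"
  and odd_part_V0: "v \<in> V0 \<Longrightarrow> odd_part v = 0" and odd_part_V1: "v \<in> V1 \<Longrightarrow> odd_part v = v"
  using decompose[of v 0] decompose[of 0 v] subspace_0[OF subspace_V0] subspace_0[OF subspace_V1]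
  by auto

lemma part_homogeneous:
  assumes "v \<in> (if c then V1 else V0)"
  shows "part b v = (if b = c then v else 0)"
  using assms by (auto simp: part_def even_part_V0 even_part_V1 odd_part_V0 odd_part_V1 split: if_splits)

lemma elem_tensor_zero_slot: "0 \<in> set vs \<Longrightarrow> elem_tensor vs = 0"
proof
  fix f assume "0 \<in> set vs"
  then obtain i where i: "i < length vs" "vs ! i = 0" by (auto simp: in_set_conv_nth)
  show "elem_tensor vs f = 0 f"
  proof (cases "multilinear (length vs) f")
    case True
    then have "Vector_Spaces.linear scale (*) (\<lambda>x. f (vs[i := x]))"
      using i by (auto simp: multilinear_def)
    then have "f (vs[i := 0]) = 0" by (rule Vector_Spaces.linear.axioms(3)[THEN module_hom.zero])
    then show ?thesis using i by (metis elem_tensor_def list_update_id zero_fun_apply)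
  qed (auto simp: elem_tensor_def)
qed

lemma perm_elem_homogeneous:
  assumes vs: "length vs = n" and e: "length e = n" and \<sigma>: "\<sigma> permutes {..<n}"
    and hom: "\<And>i. i < n \<Longrightarrow> vs ! i \<in> (if e ! i then V1 else V0)"
  shows "perm_elem n \<sigma> vs =
    tensor_scale (koszul_sign n \<sigma> (\<lambda>j. e ! j)) (elem_tensor (map (\<lambda>i. vs ! \<sigma> i) [0..<n]))"
proof -
  have s: "\<sigma> i < n" if "i < n" for i using permutes_in_image[OF \<sigma>] that by auto
  let ?g = "\<lambda>d. tensor_scale (koszul_sign n \<sigma> (\<lambda>j. d ! j))
       (elem_tensor (map (\<lambda>i. part (d ! \<sigma> i) (vs ! \<sigma> i)) [0..<n]))"
  have fin: "finite {d :: bool list. length d = n}"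
    using finite_lists_length_eq[of "UNIV :: bool set" n] by simp
  have 0: "?g d = 0" if d: "length d = n" "d \<noteq> e" for d
  proof -
    obtain j where j: "j < n" "d ! j \<noteq> e ! j" using d e by (auto simp: list_eq_iff_nth_eq)
    obtain i where i: "i < n" "\<sigma> i = j"
      using permutes_surj[OF \<sigma>] permutes_in_image[OF \<sigma>] j(1) by (metis lessThan_iff surjD)
    have "part (d ! \<sigma> i) (vs ! \<sigma> i) = 0" using part_homogeneous[OF hom[OF j(1)]] j i by auto
    then have "0 \<in> set (map (\<lambda>i. part (d ! \<sigma> i) (vs ! \<sigma> i)) [0..<n])" using i by force
    then show ?thesis by (simp add: elem_tensor_zero_slot)
  qed
  have "perm_elem n \<sigma> vs = ?g e + sum ?g ({d. length d = n} - {e})"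
    unfolding perm_elem_def using fin e by (subst sum.remove[of _ e]) auto
  also have "sum ?g ({d. length d = n} - {e}) = 0" using 0 by (intro sum.neutral) auto
  also have "map (\<lambda>i. part (e ! \<sigma> i) (vs ! \<sigma> i)) [0..<n] = map (\<lambda>i. vs ! \<sigma> i) [0..<n]"
    using part_homogeneous[OF hom] s by (intro map_cong) auto
  finally show ?thesis by simp
qed

lemma tensor_mult_elem:
  "tensor_mult (length vs) (length ws) (elem_tensor vs) (elem_tensor ws) = elem_tensor (vs @ ws)"
proof
  fix f
  let ?m = "length vs" and ?n = "length ws"
  show "tensor_mult ?m ?n (elem_tensor vs) (elem_tensor ws) f = elem_tensor (vs @ ws) f"
  proof (cases "multilinear (?m + ?n) f")
    case True
    have R: "multilinear ?n (\<lambda>ws. f (us @ ws))" if "length us = ?m" for us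
      unfolding multilinear_def
    proof (intro allI impI)
      fix xs :: "'v list" and i assume "length xs = ?n" "i < ?n"
      then show "Vector_Spaces.linear scale (*) (\<lambda>x. f (us @ xs[i := x]))"
        using True[unfolded multilinear_def, rule_format, of "us @ xs" "?m + i"] that
        by (simp add: list_update_append)
    qed
    have L: "multilinear ?m (\<lambda>us. elem_tensor ws (\<lambda>ws. f (us @ ws)))"
      unfolding multilinear_def
    proof (intro allI impI)
      fix xs :: "'v list" and i assume A: "length xs = ?m" "i < ?m"
      then show "Vector_Spaces.linear scale (*) (\<lambda>x. elem_tensor ws (\<lambda>ws. f (xs[i := x] @ ws)))"
        using True[unfolded multilinear_def, rule_format, of "xs @ ws" "i"] R
        by (simp add: list_update_append elem_tensor_def)
    qed
    show ?thesis using True L R by (simp add: tensor_mult_def elem_tensor_def)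
  qed (simp add: tensor_mult_def elem_tensor_def)
qed


lemma linear_part: "Vector_Spaces.linear scale scale (part b)"
proof (unfold Vector_Spaces.linear_iff, intro conjI allI)
  fix u v c
  obtain x y x' y' where u: "u = x + y" "x \<in> V0" "y \<in> V1" and v: "v = x' + y'" "x' \<in> V0" "y' \<in> V1"
    using sum_UNIV by metis
  have a: "x + x' \<in> V0" "y + y' \<in> V1" "scale c x \<in> V0" "scale c y \<in> V1"
    using u v subspace_V0 subspace_V1 by (auto intro: subspace_add subspace_scale)
  have s: "u + v = (x + x') + (y + y')" "scale c u = scale c x + scale c y"
    using u v by (simp_all add: algebra_simps scale_right_distrib)
  show "part b (u + v) = part b u + part b v" unfolding s(1) part_def
    using decompose[OF a(1,2)] u v decompose[OF u(2,3)] decompose[OF v(2,3)] by simp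
  show "part b (scale c u) = scale c (part b u)" unfolding s(2) part_def
    using decompose[OF a(3,4)] u decompose[OF u(2,3)] by simp
qed (rule vector_space_axioms)+

lemma sum_fun_apply: "(\<Sum>a\<in>A. g a) x = (\<Sum>a\<in>A. (g a x :: 'k))"
  by (induction A rule: infinite_finite_induct) auto

lemma perm_act_elem:
  assumes vs: "length vs = n" and \<sigma>: "\<sigma> permutes {..<n}"
  shows "perm_act n \<sigma> (elem_tensor vs) = perm_elem n \<sigma> vs"
proof
  fix f
  have "multilinear n (\<lambda>vs. perm_elem n \<sigma> vs f)"
    unfolding multilinear_def
  proof (intro allI impI)
    fix us :: "'v list" and i assume us: "length us = n" and i: "i < n"
    define j where "j = inv \<sigma> i"
    have j: "j < n" "\<sigma> j = i" "\<And>k. k \<noteq> j \<Longrightarrow> \<sigma> k \<noteq> i" "\<And>k. k \<noteq> j \<Longrightarrow> i \<noteq> \<sigma> k"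
      unfolding j_def using permutes_in_image[OF permutes_inv[OF \<sigma>]] i permutes_inverses[OF \<sigma>]
      by (auto simp: ) 
    have s: "\<sigma> k < n" if "k < n" for k using permutes_in_image[OF \<sigma>] that by auto
    have upd: "map (\<lambda>k. part (e ! \<sigma> k) (us[i := x] ! \<sigma> k)) [0..<n] =
      (map (\<lambda>k. part (e ! \<sigma> k) (us ! \<sigma> k)) [0..<n])[j := part (e ! i) x]" for e x
      by (rule nth_equalityI) (use us i j s in \<open>auto simp: nth_list_update\<close>)
    show "Vector_Spaces.linear scale (*) (\<lambda>x. perm_elem n \<sigma> (us[i := x]) f)"
    proof (cases "multilinear n f")
      case True
      have lin: "Vector_Spaces.linear scale (*)
         (\<lambda>x. f ((map (\<lambda>k. part (e ! \<sigma> k) (us ! \<sigma> k)) [0..<n])[j := part (e ! i) x]))" for e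
        using Vector_Spaces.linear_compose[OF linear_part True[unfolded multilinear_def, rule_format,
          of "map (\<lambda>k. part (e ! \<sigma> k) (us ! \<sigma> k)) [0..<n]" j]] j(1) by (simp add: o_def)
      note L = lin[unfolded Vector_Spaces.linear_iff]
      show ?thesis
        unfolding perm_elem_def Vector_Spaces.linear_iff sum_fun_apply upd
          tensor_scale_def elem_tensor_def
        using L True by (auto simp: sum.distrib[symmetric] sum_distrib_left algebra_simps intro!: sum.cong)
    next
      case False
      then have "perm_elem n \<sigma> ws f = 0" for ws
        by (simp add: perm_elem_def sum_fun_apply tensor_scale_def elem_tensor_def)
      then show ?thesis by (simp add: Vector_Spaces.linear_iff vector_space_axioms
         vector_space_over_itself.vector_space_axioms)
    qed
  qed
  then show "perm_act n \<sigma> (elem_tensor vs) f = perm_elem n \<sigma> vs f"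
    using vs by (simp add: perm_act_def elem_tensor_def)
qed


section \<open>The completed space and the exponential series\<close>

text \<open>A formal series is the sequence of its homogeneous components.\<close>

definition proj_seminorms :: "nat \<Rightarrow> (('v, 'k) tensor \<Rightarrow> real) set" where
  "proj_seminorms n = {proj_seminorm p n | p. continuous_seminorm p}"

definition sym_power_hat :: "nat \<Rightarrow> ('v, 'k) tensor filter set set" where
  "sym_power_hat n = completion (sym_power n) (proj_seminorms n)"

definition sym_embed :: "nat \<Rightarrow> ('v, 'k) tensor \<Rightarrow> ('v, 'k) tensor filter set" where
  "sym_embed n = completion_embed (sym_power n) (proj_seminorms n)"

definition series_seminorm ::
    "real \<Rightarrow> ('v \<Rightarrow> real) \<Rightarrow> (nat \<Rightarrow> ('v, 'k) tensor filter set) \<Rightarrow> ennreal" where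
  "series_seminorm R p w =
     (\<Sum>n. ennreal (completion_seminorm (proj_seminorm p n) (w n) * fact n powr R))"

definition W_hat :: "real \<Rightarrow> (nat \<Rightarrow> ('v, 'k) tensor filter set) set" where
  "W_hat R = {w. (\<forall>n. w n \<in> sym_power_hat n) \<and>
     (\<forall>p. continuous_seminorm p \<longrightarrow> series_seminorm R p w < \<infinity>)}"

definition exp_series :: "'v \<Rightarrow> nat \<Rightarrow> ('v, 'k) tensor filter set" where
  "exp_series v = (\<lambda>n. sym_embed n (tensor_scale (1 / fact n) (vpow v n)))"

definition series_zero :: "nat \<Rightarrow> ('v, 'k) tensor filter set" where
  "series_zero = (\<lambda>n. sym_embed n 0)"

definition series_add where
  "series_add w w' = (\<lambda>n. completion_add (sym_power n) (proj_seminorms n) (w n) (w' n))"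

definition series_scale where
  "series_scale c w = (\<lambda>n. completion_map (sym_power n) (proj_seminorms n) (tensor_scale c) (w n))"

definition series_diff where
  "series_diff w w' = series_add w (series_scale (-1) w')"

primrec partial_sum where
  "partial_sum a 0 = series_zero"
| "partial_sum a (Suc N) = series_add (partial_sum a N) (a N)"


section \<open>Analysis of maps into the completed space\<close>

text \<open>Convergence in the topology given by the seminorms \<^term>\<open>series_seminorm R p\<close>.\<close>

definition W_tendsto where
  "W_tendsto R f l F \<longleftrightarrow> (\<forall>p. continuous_seminorm p \<longrightarrow>
     ((\<lambda>x. series_seminorm R p (series_diff (f x) l)) \<longlongrightarrow> 0) F)"

definition W_sums where
  "W_sums R a s \<longleftrightarrow> W_tendsto R (partial_sum a) s sequentially"

definition W_abs_summable where
  "W_abs_summable R a \<longleftrightarrow> (\<forall>p. continuous_seminorm p \<longrightarrow> (\<Sum>k. series_seminorm R p (a k)) < \<infinity>)"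

definition W_has_derivative where
  "W_has_derivative R f d t \<longleftrightarrow>
     W_tendsto R (\<lambda>h. series_scale (1 / h) (series_diff (f (t + h)) (f t))) d (at 0)"

text \<open>Around every point, \<^term>\<open>f\<close> is given on all of the ground field by one power series.\<close>

definition W_analytic_infinite_radius where
  "W_analytic_infinite_radius R f \<longleftrightarrow>
     (\<forall>t0. \<exists>a. (\<forall>k. a k \<in> W_hat R) \<and>
        (\<forall>t. W_sums R (\<lambda>k. series_scale ((t - t0) ^ k) (a k)) (f t)))"

text \<open>Used over the complex numbers: differentiability at every point.\<close>

definition W_entire where
  "W_entire R f \<longleftrightarrow> (\<forall>t. \<exists>d\<in>W_hat R. W_has_derivative R f d t)"

text \<open>
  \<^term>\<open>D k\<close> is the \<^term>\<open>k\<close>-th derivative of \<^term>\<open>f\<close>; the Taylor series around every point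
  converges absolutely on the ground field, with sum \<^term>\<open>f\<close>.
\<close>

definition W_taylor_converges_absolutely where
  "W_taylor_converges_absolutely R f \<longleftrightarrow>
     (\<exists>D. D 0 = f \<and>
       (\<forall>k t. D k t \<in> W_hat R \<and> W_has_derivative R (D k) (D (Suc k) t) t) \<and>
       (\<forall>t0 t. W_abs_summable R (\<lambda>k. series_scale ((t - t0) ^ k / fact k) (D k t0)) \<and>
               W_sums R (\<lambda>k. series_scale ((t - t0) ^ k / fact k) (D k t0)) (f t)))"

end

end

theory Submission
  imports Defs
begin

text \<open>
  Whether \<open>exp v\<close> lies in the completion is a matter of the size of \<open>p\<^sup>n(v\<^sup>n) n!\<^sup>R / n!\<close>, and the
  point is that \<open>p\<^sup>n(v\<^sup>n)\<close> grows at most geometrically, and at least geometrically for a suitable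
  even vector.

  The upper bound does not hold with \<open>p v\<close> itself, since symmetrization splits vectors into their
  homogeneous components. It holds with \<open>p (v\<^sub>0) + p (v\<^sub>1)\<close> in place of \<open>p v\<close>: this seminorm is again
  continuous and dominates \<open>p\<close>, and symmetrization does not increase its projective powers
  (\<open>symmetrize_cost\<close>, \<open>proj_seminorm_vpow_le\<close>). For \<open>R < 1\<close> the series
  \<open>\<Sum> x\<^sup>n n!\<^sup>R / n!\<close> then converges for all \<open>x\<close>.

  For \<open>R \<ge> 1\<close>, an even vector \<open>w \<noteq> 0\<close> satisfies \<open>w\<^sup>n = w \<otimes> \<dots> \<otimes> w\<close>. Local convexity, the
  Hausdorff property and the Hahn-Banach theorem (\<open>hahn_banach\<close>, \<open>real_functional_separating\<close>) give a
  continuous linear functional \<open>\<phi>\<close> with \<open>\<phi> w = 1\<close> after rescaling \<open>w\<close>. The form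
  \<open>v\<^sub>1, \<dots>, v\<^sub>n \<mapsto> \<phi> v\<^sub>1 \<cdots> \<phi> v\<^sub>n\<close> shows that \<open>w\<^sup>n\<close> has size at least 1 for the seminorm \<open>\<bar>\<phi>\<bar>\<close>
  (\<open>proj_seminorm_replicate_ge\<close>), and so the series of seminorms diverges.

  Analyticity is a statement on scalar power series. Everything that occurs for fixed \<open>v\<close> (values,
  derivatives, difference quotients, Taylor polynomials) has components \<open>c\<^sub>n v\<^sup>n\<close> with scalars
  \<open>c\<^sub>n\<close>, and by \<open>series_seminorm_coeff_le\<close> a bound \<open>\<bar>c\<^sub>n\<bar> \<le> K x\<^sup>n / n!\<close> for all \<open>n\<close> bounds all the
  seminorms by \<open>K\<close> times a finite number depending on \<open>x\<close>. So it suffices to prove such bounds with one \<open>x\<close> and with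
  \<open>K\<close> tending to 0: \<open>K\<close> is a multiple of \<open>\<bar>h\<bar>\<close> for the difference quotients
  (\<open>difference_quotient_power_le\<close>), and \<open>2\<^sup>-\<^sup>N\<close> for the remainders of the Taylor series
  (\<open>binomial_tail_le\<close>).
\<close>

section \<open>Continuous linear functionals\<close>

definition sublinear :: "(real \<Rightarrow> 'v::ab_group_add \<Rightarrow> 'v) \<Rightarrow> ('v \<Rightarrow> real) \<Rightarrow> bool" where
  "sublinear s q \<longleftrightarrow> (\<forall>x y. q (x + y) \<le> q x + q y) \<and> (\<forall>t>0. \<forall>x. q (s t x) = t * q x)"

context
  fixes s :: "real \<Rightarrow> 'v::ab_group_add \<Rightarrow> 'v"
  assumes vs: "vector_space s"
begin

interpretation vector_space s by (rule vs)

lemma sublinearI: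
  assumes "\<And>x y. q (x + y) \<le> q x + q y" and le: "\<And>t x. t > 0 \<Longrightarrow> q (s t x) \<le> t * q x"
  shows "sublinear s q"
  unfolding sublinear_def
proof (intro conjI allI impI)
  fix t :: real and x assume t: "t > 0"
  have "q (s (1 / t) (s t x)) \<le> 1 / t * q (s t x)" using t by (intro le) auto
  then have "t * q x \<le> q (s t x)" using t by (simp add: field_simps)
  with le[OF t, of x] show "q (s t x) = t * q x" by simp
qed (use assms in auto)

lemma sublinear_zero: "sublinear s q \<Longrightarrow> q 0 = 0"
proof -
  assume "sublinear s q"
  then have "q (s 2 0) = 2 * q 0" unfolding sublinear_def by (metis zero_less_numeral)
  then show ?thesis by simp
qed

lemma sublinear_nonneg_scale: "sublinear s q \<Longrightarrow> t \<ge> 0 \<Longrightarrow> q (s t x) = t * q x"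
  using sublinear_zero[of q] by (cases "t = 0") (auto simp: sublinear_def)

lemma sublinear_ge_neg: "sublinear s q \<Longrightarrow> - q (- x) \<le> q x"
proof -
  assume q: "sublinear s q"
  then have "q (x + - x) \<le> q x + q (- x)" unfolding sublinear_def by blast
  then show ?thesis using sublinear_zero[OF q] by simp
qed

text \<open>
  The largest sublinear function below \<open>q\<close> that is at most \<open>- q a\<close> at \<open>- a\<close>, hence affine along
  the direction \<open>a\<close>.
\<close>

definition tilt :: "('v \<Rightarrow> real) \<Rightarrow> 'v \<Rightarrow> 'v \<Rightarrow> real" where
  "tilt q a x = (INF t\<in>{0..}. q (x + s t a) - t * q a)"

lemma
  assumes q: "sublinear s q"
  shows tilt_le: "t \<ge> 0 \<Longrightarrow> tilt q a x \<le> q (x + s t a) - t * q a"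
    and tilt_greatest: "(\<And>t. t \<ge> 0 \<Longrightarrow> m \<le> q (x + s t a) - t * q a) \<Longrightarrow> m \<le> tilt q a x"
proof -
  have "- q (- x) \<le> q (x + s t a) - t * q a" if "t \<ge> 0" for t
  proof -
    have "q (- x + (x + s t a)) \<le> q (- x) + q (x + s t a)" using q unfolding sublinear_def by blast
    then show ?thesis using sublinear_nonneg_scale[OF q that, of a] by simp
  qed
  then have "bdd_below ((\<lambda>t. q (x + s t a) - t * q a) ` {0..})"
    by (auto intro!: bdd_belowI[of _ "- q (- x)"])
  then show "t \<ge> 0 \<Longrightarrow> tilt q a x \<le> q (x + s t a) - t * q a"
    unfolding tilt_def by (rule cINF_lower) simp
qed (auto simp: tilt_def intro!: cINF_greatest)

lemma sublinear_tilt: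
  assumes q: "sublinear s q" shows "sublinear s (tilt q a)"
proof (rule sublinearI)
  fix x y
  have "tilt q a (x + y) - (q (y + s u a) - u * q a) \<le> q (x + s t a) - t * q a"
    if "t \<ge> 0" "u \<ge> 0" for t u
  proof -
    have "tilt q a (x + y) \<le> q (x + y + s (t + u) a) - (t + u) * q a" using that by (intro tilt_le q) auto
    also have "x + y + s (t + u) a = (x + s t a) + (y + s u a)" by (simp add: scale_left_distrib algebra_simps)
    also have "q \<dots> \<le> q (x + s t a) + q (y + s u a)" using q by (auto simp: sublinear_def)
    finally show ?thesis by (simp add: algebra_simps)
  qed
  then have "tilt q a (x + y) - tilt q a x \<le> q (y + s u a) - u * q a" if "u \<ge> 0" for u
    using tilt_greatest[OF q, of "tilt q a (x + y) - (q (y + s u a) - u * q a)" x a] that by fastforce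
  then show "tilt q a (x + y) \<le> tilt q a x + tilt q a y"
    using tilt_greatest[OF q, of "tilt q a (x + y) - tilt q a x" y a] by fastforce
next
  fix r :: real and x assume r: "r > 0"
  have "tilt q a (s r x) / r \<le> q (x + s t a) - t * q a" if "t \<ge> 0" for t
  proof -
    have "tilt q a (s r x) \<le> q (s r x + s (r * t) a) - (r * t) * q a" using r that by (intro tilt_le q) auto
    also have "s r x + s (r * t) a = s r (x + s t a)" by (simp add: scale_right_distrib)
    also have "q \<dots> = r * q (x + s t a)" using q r by (auto simp: sublinear_def)
    finally show ?thesis using r by (simp add: field_simps)
  qed
  then have "tilt q a (s r x) / r \<le> tilt q a x" by (intro tilt_greatest q)
  then show "tilt q a (s r x) \<le> r * tilt q a x" using r by (simp add: field_simps)
qed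

text \<open>
  A minimal sublinear function coincides with all its tilts, which makes it additive.
\<close>

lemma minimal_sublinear_linear:
  assumes q: "sublinear s q" and min: "\<And>r. sublinear s r \<Longrightarrow> (\<And>x. r x \<le> q x) \<Longrightarrow> r = q"
  shows "Vector_Spaces.linear s (*) q"
proof -
  have add: "q (x + a) = q x + q a" for x a
  proof (rule antisym)
    have "tilt q a x \<le> q x" for x using tilt_le[OF q, of 0 a x] by simp
    then have "tilt q a = q" by (intro min sublinear_tilt q)
    then show "q x + q a \<le> q (x + a)" using tilt_le[OF q, of 1 a x] by simp
  qed (use q in \<open>auto simp: sublinear_def\<close>)
  have neg: "q (- x) = - q x" for x using add[of x "- x"] sublinear_zero[OF q] by simp
  have "q (s t x) = t * q x" for t x
  proof (cases "t \<ge> 0")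
    case False
    then have "q (s (- t) x) = - t * q x" by (intro sublinear_nonneg_scale q) auto
    then show ?thesis using neg[of "s t x"] by (simp add: scale_minus_left)
  qed (rule sublinear_nonneg_scale[OF q])
  with add show ?thesis
    by (simp add: Vector_Spaces.linear_iff vs vector_space_over_itself.vector_space_axioms)
qed

text \<open>
  By Zorn's lemma there is a minimal sublinear function below \<open>tilt g v\<close>; tilting first is what
  forces the value at \<open>v\<close>.
\<close>

theorem hahn_banach:
  assumes g: "sublinear s g"
  obtains f where "Vector_Spaces.linear s (*) f" "\<And>x. f x \<le> g x" "f v = g v"
proof -
  let ?h = "tilt g v"
  define A where "A = {q. sublinear s q \<and> (\<forall>x. q x \<le> ?h x)}"
  define P :: "('v \<Rightarrow> real) \<Rightarrow> ('v \<Rightarrow> real) \<Rightarrow> bool" where "P q r \<longleftrightarrow> (\<forall>x. r x \<le> q x)" for q r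
  have h: "sublinear s ?h" by (rule sublinear_tilt[OF g])
  have "\<exists>m\<in>A. \<forall>a\<in>A. P m a \<longrightarrow> a = m"
  proof (rule predicate_Zorn)
    show "partial_order_on A (relation_of P A)"
      by (rule partial_order_on_relation_ofI) (auto simp: P_def fun_eq_iff intro: order_trans antisym)
  next
    fix C assume "C \<in> Chains (relation_of P A)"
    then have CA: "C \<subseteq> A" and lin: "\<And>q r. q \<in> C \<Longrightarrow> r \<in> C \<Longrightarrow> P q r \<or> P r q"
      unfolding Chains_def relation_of_def by auto
    show "\<exists>u\<in>A. \<forall>a\<in>C. P a u"
    proof (cases "C = {}")
      case True
      then show ?thesis using h by (auto simp: A_def)
    next
      case False
      define u where "u x = (INF q\<in>C. q x)" for x
      have "- ?h (- x) \<le> q x" if "q \<in> C" for q x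
        using that CA sublinear_ge_neg[of q x] unfolding A_def by (smt (verit) mem_Collect_eq subset_eq)
      then have bdd: "bdd_below ((\<lambda>q. q x) ` C)" for x by (auto intro!: bdd_belowI[of _ "- ?h (- x)"])
      have ule: "u x \<le> q x" if "q \<in> C" for q x unfolding u_def using bdd that by (rule cINF_lower)
      have ug: "m \<le> u x" if "\<And>q. q \<in> C \<Longrightarrow> m \<le> q x" for m x
        unfolding u_def using False that by (rule cINF_greatest)
      have "sublinear s u"
      proof (rule sublinearI)
        fix x y
        have "u (x + y) - r y \<le> q x" if qr: "q \<in> C" "r \<in> C" for q r
        proof -
          obtain m where m: "m \<in> C" "\<And>z. m z \<le> q z" "\<And>z. m z \<le> r z"
            using lin[OF qr] qr unfolding P_def by blast
          have "u (x + y) \<le> m (x + y)" by (rule ule[OF m(1)])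
          also have "\<dots> \<le> m x + m y" using m(1) CA by (auto simp: A_def sublinear_def)
          finally show ?thesis using m(2)[of x] m(3)[of y] by simp
        qed
        then have "u (x + y) - r y \<le> u x" if "r \<in> C" for r using that by (intro ug) auto
        then have "u (x + y) - u x \<le> r y" if "r \<in> C" for r using that by (simp add: algebra_simps)
        then have "u (x + y) - u x \<le> u y" by (rule ug)
        then show "u (x + y) \<le> u x + u y" by simp
      next
        fix t :: real and x assume t: "t > 0"
        have "u (s t x) / t \<le> q x" if "q \<in> C" for q
          using ule[OF that, of "s t x"] t that CA by (auto simp: A_def sublinear_def field_simps)
        then have "u (s t x) / t \<le> u x" by (rule ug)
        then show "u (s t x) \<le> t * u x" using t by (simp add: field_simps)
      qed
      moreover have "u x \<le> ?h x" for x
      proof -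
        obtain q where "q \<in> C" using False by blast
        then show ?thesis using ule[of q x] CA unfolding A_def by (smt (verit) mem_Collect_eq subset_eq)
      qed
      ultimately show ?thesis using ule by (auto simp: A_def P_def)
    qed
  qed
  then obtain f where fA: "f \<in> A" and f_min: "\<And>r. r \<in> A \<Longrightarrow> P f r \<Longrightarrow> r = f" by blast
  have f: "sublinear s f" "f x \<le> ?h x" for x using fA by (auto simp: A_def)
  have min: "r = f" if "sublinear s r" "\<And>x. r x \<le> f x" for r
    using that f(2) by (intro f_min) (auto simp: A_def P_def intro: order_trans)
  have lin: "Vector_Spaces.linear s (*) f" using f(1) min by (rule minimal_sublinear_linear)
  have le: "f x \<le> g x" for x using f(2)[of x] tilt_le[OF g, of 0 v x] by simp
  have "f (- v) = - f v"
    using lin[unfolded Vector_Spaces.linear_iff] by (metis add.right_inverse add_eq_0_iff sublinear_zero[OF f(1)])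
  moreover have "f (- v) \<le> - g v"
    using f(2)[of "- v"] tilt_le[OF g, of 1 v "- v"] sublinear_zero[OF g] by simp
  ultimately have "f v = g v" using le[of v] by simp
  with lin le show ?thesis using that by blast
qed

end

context graded_lcs
begin

lemma vector_space_real: "vector_space (\<lambda>t. scale (of_real t))"
  by standard (simp_all add: scale_right_distrib scale_left_distrib)

lemma continuous_on_scale_right: "continuous_on UNIV (scale c)"
proof -
  have "continuous_on UNIV (\<lambda>x::'v. (c, x))" by (intro continuous_intros)
  from continuous_on_compose2[OF continuous_scale this] show ?thesis by simp
qed

lemma continuous_on_scale_left: "continuous_on UNIV (\<lambda>c. scale c x)"
proof -
  have "continuous_on UNIV (\<lambda>c::'k. (c, x))" by (intro continuous_intros)
  from continuous_on_compose2[OF continuous_scale this] show ?thesis by simp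
qed

text \<open>
  The gauge of a convex neighbourhood of 0 that misses \<open>v\<close> is sublinear, and a linear function
  below it is bounded above on the neighbourhood, hence continuous. Only real scalars enter, so
  the neighbourhood need not be balanced.
\<close>

lemma real_functional_separating:
  assumes v: "v \<noteq> 0"
  obtains f where "\<And>x y. f (x + y) = f x + f y" "\<And>t x. f (scale (of_real t) x) = t * f x"
    "continuous_on UNIV f" "f v \<noteq> (0::real)"
proof -
  let ?s = "\<lambda>t. scale (of_real t)"
  obtain U where U: "open U" "0 \<in> U" "v \<notin> U" using t1_space[of 0 v] v by metis
  obtain W where W: "open W" "0 \<in> W" "W \<subseteq> U"
    and conv: "\<And>x y a. x \<in> W \<Longrightarrow> y \<in> W \<Longrightarrow> 0 \<le> a \<Longrightarrow> a \<le> 1 \<Longrightarrow> ?s a x + ?s (1 - a) y \<in> W"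
    using locally_convex[OF U(1,2)] by (metis atLeastAtMost_iff)
  define T where "T x = {t. t > 0 \<and> ?s (1 / t) x \<in> W}" for x
  define g where "g x = Inf (T x)" for x
  have absorb: "\<exists>t. t \<in> T x" for x
  proof -
    have "open ((\<lambda>t::real. ?s t x) -` W)"
      by (intro open_vimage W continuous_on_compose2[OF continuous_on_scale_left] continuous_intros) auto
    moreover have "0 \<in> (\<lambda>t::real. ?s t x) -` W" using W by simp
    ultimately obtain e where e: "e > 0" "ball 0 e \<subseteq> (\<lambda>t::real. ?s t x) -` W"
      by (meson open_contains_ball)
    then have "?s (e / 2) x \<in> W" using subsetD[OF e(2), of "e / 2"] by (simp del: of_real_divide)
    then have "2 / e \<in> T x" using e by (simp add: T_def)
    then show ?thesis ..
  qed
  have bdd: "bdd_below (T x)" for x by (rule bdd_belowI[of _ 0]) (auto simp: T_def)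
  have gle: "g x \<le> t" if "t \<in> T x" for x t unfolding g_def using that bdd by (intro cInf_lower)
  have gg: "m \<le> g x" if "\<And>t. t \<in> T x \<Longrightarrow> m \<le> t" for x m
    unfolding g_def using that absorb by (intro cInf_greatest) auto
  have g: "sublinear ?s g"
  proof (rule sublinearI[OF vector_space_real])
    fix x y
    have "g (x + y) - u \<le> t" if "t \<in> T x" "u \<in> T y" for t u
    proof -
      have tu: "t > 0" "u > 0" "?s (1 / t) x \<in> W" "?s (1 / u) y \<in> W" using that by (auto simp: T_def)
      have "?s (t / (t + u)) (?s (1 / t) x) + ?s (1 - t / (t + u)) (?s (1 / u) y) \<in> W"
        using tu by (intro conv) (auto simp: field_simps)
      moreover have "?s (t / (t + u)) (?s (1 / t) x) = ?s (1 / (t + u)) x"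
        using tu by (simp add: of_real_mult[symmetric] del: of_real_mult of_real_divide)
      moreover have "(1 - t / (t + u)) * (1 / u) = 1 / (t + u)" using tu by (simp add: field_simps)
      then have "?s (1 - t / (t + u)) (?s (1 / u) y) = ?s (1 / (t + u)) y"
        by (simp add: of_real_mult[symmetric] del: of_real_mult of_real_divide of_real_diff)
      ultimately have "t + u \<in> T (x + y)" using tu unfolding T_def by (auto simp: scale_right_distrib)
      then show ?thesis using gle by fastforce
    qed
    then have "g (x + y) - u \<le> g x" if "u \<in> T y" for u using that by (intro gg) auto
    then have "g (x + y) - g x \<le> u" if "u \<in> T y" for u using that by (simp add: algebra_simps)
    then have "g (x + y) - g x \<le> g y" by (rule gg)
    then show "g (x + y) \<le> g x + g y" by simp
  next
    fix r :: real and x assume r: "r > 0"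
    have "g (?s r x) / r \<le> t" if "t \<in> T x" for t
    proof -
      have "1 / (r * t) * r = 1 / t" using r that by (simp add: T_def)
      then have "?s (1 / (r * t)) (?s r x) = ?s (1 / t) x"
        by (simp add: of_real_mult[symmetric] del: of_real_mult of_real_divide)
      then have "r * t \<in> T (?s r x)" using that r by (simp add: T_def)
      then show ?thesis using gle r by (fastforce simp: field_simps)
    qed
    then have "g (?s r x) / r \<le> g x" by (rule gg)
    then show "g (?s r x) \<le> r * g x" using r by (simp add: field_simps)
  qed
  have "1 \<le> g v"
  proof (rule gg, rule ccontr)
    fix t assume t: "t \<in> T v" "\<not> 1 \<le> t"
    then have "?s t (?s (1 / t) v) + ?s (1 - t) 0 \<in> W" using W by (intro conv) (auto simp: T_def)
    moreover have "?s t (?s (1 / t) v) = v" using t by (simp add: T_def)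
    ultimately show False using W U by auto
  qed
  obtain f where f: "Vector_Spaces.linear ?s (*) f" "\<And>x. f x \<le> g x" "f v = g v"
    using hahn_banach[OF vector_space_real g] by blast
  have add: "f (x + y) = f x + f y" and sc: "f (?s t x) = t * f x" for x y t
    using f(1) by (auto simp: Vector_Spaces.linear_iff)
  have neg: "f (- x) = - f x" for x using sc[of "-1" x] by (simp add: scale_minus_left)
  have fW: "f x \<le> 1" if "x \<in> W" for x
    using f(2)[of x] gle[of 1 x] that by (auto simp: T_def)
  have "(f \<longlongrightarrow> f x) (at x)" for x
  proof (rule tendstoI)
    fix e :: real assume e: "e > 0"
    define N where "N = (\<lambda>y. ?s (2 / e) (y - x)) -` W \<inter> (\<lambda>y. ?s (2 / e) (x - y)) -` W"
    have "open N" unfolding N_def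
      by (intro open_Int open_vimage W continuous_on_compose2[OF continuous_on_scale_right] continuous_intros) auto
    moreover have "x \<in> N" using W by (simp add: N_def)
    moreover have "dist (f y) (f x) < e" if "y \<in> N" for y
    proof -
      have "f (?s (2 / e) (y - x)) \<le> 1" "f (?s (2 / e) (x - y)) \<le> 1"
        using that fW unfolding N_def by blast+
      then have "f (y - x) \<le> e / 2" "f (x - y) \<le> e / 2" unfolding sc using e by (auto simp: field_simps)
      moreover have "f (y - x) = f y - f x" "f (x - y) = f x - f y"
        using add[of y "- x"] add[of x "- y"] neg by auto
      ultimately show ?thesis using e by (auto simp: dist_real_def)
    qed
    ultimately show "\<forall>\<^sub>F y in at x. dist (f y) (f x) < e"
      by (auto simp: eventually_at_topological)
  qed
  then have "continuous_on UNIV f" by (simp add: continuous_on_def)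
  with add sc f(3) \<open>1 \<le> g v\<close> show ?thesis by (intro that[of f]) auto
qed

end

lemma real_functional:
  fixes s :: "real \<Rightarrow> 'v::{t2_space, topological_ab_group_add} \<Rightarrow> 'v"
  assumes "graded_lcs s V0 V1" "v \<noteq> 0"
  obtains \<phi> where "Vector_Spaces.linear s (*) \<phi>" "continuous_on UNIV \<phi>" "\<phi> v \<noteq> 0"
proof -
  interpret graded_lcs s V0 V1 by fact
  obtain f where "\<And>x y. f (x + y) = f x + f y" "\<And>t x. f (s (of_real t) x) = t * f x"
    "continuous_on UNIV f" "f v \<noteq> 0" using real_functional_separating[OF assms(2)] by metis
  then show ?thesis by (intro that[of f])
    (auto simp: Vector_Spaces.linear_iff vector_space_axioms vector_space_over_itself.vector_space_axioms)
qed

text \<open>A real-linear \<open>f\<close> is the real part of the complex-linear \<open>x \<mapsto> f x - \<i> f (\<i> x)\<close>.\<close>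

lemma complex_functional:
  fixes s :: "complex \<Rightarrow> 'v::{t2_space, topological_ab_group_add} \<Rightarrow> 'v"
  assumes "graded_lcs s V0 V1" "v \<noteq> 0"
  obtains \<phi> where "Vector_Spaces.linear s (*) \<phi>" "continuous_on UNIV \<phi>" "\<phi> v \<noteq> 0"
proof -
  interpret graded_lcs s V0 V1 by fact
  obtain f where add: "\<And>x y. f (x + y) = f x + f y" and sc: "\<And>t x. f (s (of_real t) x) = t * f x"
    and cont: "continuous_on UNIV f" and v: "f v \<noteq> 0" using real_functional_separating[OF assms(2)] by metis
  define \<phi> where "\<phi> x = Complex (f x) (- f (s \<i> x))" for x
  have sc': "f (s c x) = Re c * f x + Im c * f (s \<i> x)" for c x
  proof -
    have "s c x = s (of_real (Re c)) x + s (of_real (Im c)) (s \<i> x)"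
      by (metis scale_left_distrib scale_scale complex_eq mult.commute)
    then show ?thesis by (simp only: add sc)
  qed
  have \<phi>_scale: "\<phi> (s c x) = c * \<phi> x" for c x
    using sc'[of c x] sc'[of "\<i> * c" x] by (simp add: \<phi>_def complex_eq_iff algebra_simps)
  have \<phi>_add: "\<phi> (x + y) = \<phi> x + \<phi> y" for x y
    by (simp add: \<phi>_def complex_eq_iff add scale_right_distrib)
  have \<phi>_cont: "continuous_on UNIV \<phi>"
    unfolding \<phi>_def Complex_eq
    by (intro continuous_intros cont continuous_on_compose2[OF cont continuous_on_scale_right]) auto
  have "Vector_Spaces.linear s (*) \<phi>"
    using \<phi>_scale \<phi>_add unfolding Vector_Spaces.linear_iff
    by (intro conjI allI vector_space_axioms vector_space_over_itself.vector_space_axioms)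
  moreover have "\<phi> v \<noteq> 0" using v by (simp add: \<phi>_def complex_eq_iff)
  ultimately show ?thesis using \<phi>_cont that by blast
qed


section \<open>Points of the completion that come from the space itself\<close>

lemma eventually_prod_filterI:
  assumes "eventually A F" "eventually B G" "\<And>a b. A a \<Longrightarrow> B b \<Longrightarrow> P a b"
  shows "\<forall>\<^sub>F z in F \<times>\<^sub>F G. P (fst z) (snd z)"
  unfolding eventually_prod_filter
  by (intro exI[of _ A] exI[of _ B]) (use assms in auto)

text \<open>
  Every series below has its components in the image of the embedding. Such a component is the
  class of all filters converging to a given point, so the operations of the completion can be
  computed on points.
\<close>

locale seminormed_group =
  fixes E :: "'e::ab_group_add set" and Q :: "('e \<Rightarrow> real) set"
  assumes zero_in: "0 \<in> E"
    and add_in: "x \<in> E \<Longrightarrow> y \<in> E \<Longrightarrow> x + y \<in> E"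
    and uminus_in: "x \<in> E \<Longrightarrow> - x \<in> E"
    and zero: "q \<in> Q \<Longrightarrow> q 0 = 0"
    and triangle: "q \<in> Q \<Longrightarrow> x \<in> E \<Longrightarrow> y \<in> E \<Longrightarrow> q (x + y) \<le> q x + q y"
    and uminus: "q \<in> Q \<Longrightarrow> x \<in> E \<Longrightarrow> q (- x) = q x"
begin

lemma diff_in: "x \<in> E \<Longrightarrow> y \<in> E \<Longrightarrow> x - y \<in> E"
  using add_in[OF _ uminus_in, of x y] by simp

lemma commute: "q \<in> Q \<Longrightarrow> x \<in> E \<Longrightarrow> y \<in> E \<Longrightarrow> q (x - y) = q (y - x)"
  using uminus[OF _ diff_in, of q x y] by simp

lemma triangle_diff: "q \<in> Q \<Longrightarrow> x \<in> E \<Longrightarrow> y \<in> E \<Longrightarrow> z \<in> E \<Longrightarrow> q (x - z) \<le> q (x - y) + q (y - z)"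
  using triangle[OF _ diff_in diff_in, of q x y y z] by simp

lemma reverse_triangle: "q \<in> Q \<Longrightarrow> x \<in> E \<Longrightarrow> y \<in> E \<Longrightarrow> \<bar>q x - q y\<bar> \<le> q (x - y)"
  using triangle_diff[of q x y 0] triangle_diff[of q y x 0] commute[of q x y] zero_in by (simp add: abs_le_iff)

definition converges :: "'e filter \<Rightarrow> 'e \<Rightarrow> bool" where
  "converges F x \<longleftrightarrow> F \<noteq> bot \<and> (\<forall>\<^sub>F y in F. y \<in> E) \<and>
     (\<forall>q\<in>Q. \<forall>e>0. \<forall>\<^sub>F y in F. q (x - y) < e)"

lemma converges_close: "converges F x \<Longrightarrow> q \<in> Q \<Longrightarrow> e > 0 \<Longrightarrow> \<forall>\<^sub>F y in F. y \<in> E \<and> q (x - y) < e / 2"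
  unfolding converges_def by (intro eventually_conj) (use half_gt_zero in blast)+

lemma eventually_close:
  assumes F: "converges F x" and G: "converges G x" and x: "x \<in> E" and q: "q \<in> Q" and e: "e > 0"
  shows "\<forall>\<^sub>F z in F \<times>\<^sub>F G. q (fst z - snd z) < e"
proof -
  have "q (a - b) < e" if "a \<in> E" "q (x - a) < e / 2" "b \<in> E" "q (x - b) < e / 2" for a b
    using triangle_diff[of q a x b] commute[of q a x] that x q by simp
  then show ?thesis
    by (intro eventually_prod_filterI[OF converges_close[OF F q e] converges_close[OF G q e]]) auto
qed

lemma converges_cauchy: "x \<in> E \<Longrightarrow> converges F x \<Longrightarrow> F \<in> cauchy_filters E Q"
  unfolding cauchy_filters_def using eventually_close[of F x F]
  by (auto simp: converges_def)

lemma converges_principal: "x \<in> E \<Longrightarrow> converges (principal {x}) x"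
  by (simp add: converges_def eventually_principal principal_eq_bot_iff zero)

lemma cauchy_equiv_class:
  assumes x: "x \<in> E" and F: "converges F x"
  shows "cauchy_equiv E Q `` {F} = {G. converges G x}"
proof (intro set_eqI iffI; clarsimp)
  fix G assume "converges G x"
  then show "(F, G) \<in> cauchy_equiv E Q"
    unfolding cauchy_equiv_def
    using eventually_close[OF F _ x] converges_cauchy F x by auto
next
  fix G assume FG: "(F, G) \<in> cauchy_equiv E Q"
  then have G: "G \<noteq> bot" "\<forall>\<^sub>F y in G. y \<in> E" by (auto simp: cauchy_equiv_def cauchy_filters_def)
  have "\<forall>\<^sub>F y in G. q (x - y) < e" if q: "q \<in> Q" and e: "e > 0" for q e
  proof -
    have "\<forall>\<^sub>F z in F \<times>\<^sub>F G. q (fst z - snd z) < e / 2"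
      using FG q half_gt_zero[OF e] unfolding cauchy_equiv_def by blast
    then obtain A B where AB: "eventually A F" "eventually B G" "\<And>a b. A a \<Longrightarrow> B b \<Longrightarrow> q (a - b) < e / 2"
      unfolding eventually_prod_filter by auto
    have "\<forall>\<^sub>F a in F. A a \<and> a \<in> E \<and> q (x - a) < e / 2"
      using AB(1) converges_close[OF F q e] by (rule eventually_conj)
    moreover have "F \<noteq> bot" using F by (simp add: converges_def)
    ultimately obtain a where a: "A a" "a \<in> E" "q (x - a) < e / 2"
      using eventually_happens' by blast
    from G(2) AB(2) show ?thesis
      by eventually_elim (use a AB(3) triangle_diff[OF q x a(2)] in fastforce)
  qed
  then show "converges G x" using G by (simp add: converges_def)
qed

lemma completion_embed_eq: "x \<in> E \<Longrightarrow> completion_embed E Q x = {F. converges F x}"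
  unfolding completion_embed_def by (intro cauchy_equiv_class converges_principal)

lemma completion_embed_in: "x \<in> E \<Longrightarrow> completion_embed E Q x \<in> completion E Q"
  unfolding completion_def completion_embed_def
  by (intro quotientI converges_cauchy[OF _ converges_principal])

lemma completion_add_embed:
  assumes x: "x \<in> E" and y: "y \<in> E"
  shows "completion_add E Q (completion_embed E Q x) (completion_embed E Q y) = completion_embed E Q (x + y)"
proof -
  have conv: "converges (filtermap (\<lambda>z. fst z + snd z) (F \<times>\<^sub>F G)) (x + y)"
    if F: "converges F x" and G: "converges G y" for F G
    unfolding converges_def eventually_filtermap
  proof (intro conjI ballI allI impI)
    show "filtermap (\<lambda>z. fst z + snd z) (F \<times>\<^sub>F G) \<noteq> bot"
      using F G by (simp add: converges_def filtermap_bot_iff prod_filter_eq_bot)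
    show "\<forall>\<^sub>F z in F \<times>\<^sub>F G. fst z + snd z \<in> E"
      by (rule eventually_prod_filterI[of "\<lambda>a. a \<in> E" _ "\<lambda>b. b \<in> E"])
        (use F G in \<open>auto simp: converges_def add_in\<close>)
    fix q and e :: real assume q: "q \<in> Q" and e: "e > 0"
    have "q (x + y - (a + b)) < e" if "a \<in> E" "q (x - a) < e / 2" "b \<in> E" "q (y - b) < e / 2" for a b
      using triangle[OF q diff_in diff_in, of x a y b] that x y by (simp add: algebra_simps)
    then show "\<forall>\<^sub>F z in F \<times>\<^sub>F G. q (x + y - (fst z + snd z)) < e"
      by (intro eventually_prod_filterI[OF converges_close[OF F q e] converges_close[OF G q e]]) auto
  qed
  show ?thesis
    unfolding completion_add_def completion_embed_eq[OF x] completion_embed_eq[OF y]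
      completion_embed_eq[OF add_in[OF x y]]
    using cauchy_equiv_class[OF add_in[OF x y] conv] converges_principal x y by blast
qed

lemma completion_map_embed:
  assumes x: "x \<in> E" and g: "\<And>y. y \<in> E \<Longrightarrow> g y \<in> E"
    and lip: "\<And>q y. q \<in> Q \<Longrightarrow> y \<in> E \<Longrightarrow> q (g x - g y) \<le> K * q (x - y)" and K: "K \<ge> 0"
  shows "completion_map E Q g (completion_embed E Q x) = completion_embed E Q (g x)"
proof -
  have conv: "converges (filtermap g F) (g x)" if F: "converges F x" for F
    unfolding converges_def eventually_filtermap
  proof (intro conjI ballI allI impI)
    show "filtermap g F \<noteq> bot" using F by (simp add: converges_def filtermap_bot_iff)
    show "\<forall>\<^sub>F z in F. g z \<in> E"
      using F g unfolding converges_def by (auto elim: eventually_mono)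
    fix q and e :: real assume q: "q \<in> Q" and e: "e > 0"
    have "\<forall>\<^sub>F y in F. q (x - y) < e / (K + 1)" "\<forall>\<^sub>F y in F. y \<in> E"
      using F q e K unfolding converges_def by auto
    then show "\<forall>\<^sub>F y in F. q (g x - g y) < e"
    proof eventually_elim
      case (elim y)
      have "0 \<le> q (x - y)"
        using reverse_triangle[OF q x elim(2)] by simp
      then have "K * q (x - y) \<le> (K + 1) * q (x - y)" by (intro mult_right_mono) auto
      also have "\<dots> < e" using elim K by (simp add: field_simps)
      finally show ?case using lip[OF q elim(2)] by simp
    qed
  qed
  show ?thesis
    unfolding completion_map_def completion_embed_eq[OF x] completion_embed_eq[OF g[OF x]]
    using cauchy_equiv_class[OF g[OF x] conv] converges_principal[OF x] by blast
qed

lemma completion_seminorm_embed: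
  "x \<in> E \<Longrightarrow> q \<in> Q \<Longrightarrow> completion_seminorm q (completion_embed E Q x) = q x"
  by (rule Defs.completion_seminorm_embed) (auto simp: zero reverse_triangle)

end


section \<open>Projective seminorms through costs of representations\<close>

context graded_lcs
begin

lemma continuous_seminorm_nonneg: "continuous_seminorm p \<Longrightarrow> 0 \<le> p x"
proof -
  assume p: "continuous_seminorm p"
  have "p 0 = 0" "p (- x) = p x"
    using p scale_zero_left scale_minus_left[of 1 x]
    unfolding continuous_seminorm_def by (metis norm_zero mult_zero_left, metis norm_minus_cancel norm_one mult_1 scale_one)
  moreover have "p (x + - x) \<le> p x + p (- x)" using p unfolding continuous_seminorm_def by blast
  ultimately show ?thesis by simp
qed

text \<open>
  Upper bounds for a projective seminorm are proved by following the cost of one representation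
  through an operation, without handling infima.
\<close>

definition rep_costs :: "('v \<Rightarrow> real) \<Rightarrow> nat \<Rightarrow> ('v, 'k) tensor \<Rightarrow> real set" where
  "rep_costs p n x = {\<Sum>(c, vs)\<leftarrow>zs. norm c * prod_list (map p vs) | zs.
     (\<forall>(c, vs)\<in>set zs. length vs = n) \<and> x = (\<Sum>(c, vs)\<leftarrow>zs. tensor_scale c (elem_tensor vs))}"

lemma proj_seminorm_eq: "proj_seminorm p n x = Inf (rep_costs p n x)"
  by (simp add: proj_seminorm_def rep_costs_def)

lemma rep_costsI:
  "(\<forall>(c, vs)\<in>set zs. length vs = n) \<Longrightarrow>
   (\<Sum>(c, vs)\<leftarrow>zs. norm c * prod_list (map p vs))
     \<in> rep_costs p n (\<Sum>(c, vs)\<leftarrow>zs. tensor_scale c (elem_tensor vs))"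
  by (auto simp: rep_costs_def)

lemma rep_costsE:
  assumes "s \<in> rep_costs p n x"
  obtains zs where "\<forall>(c, vs)\<in>set zs. length vs = n"
    "s = (\<Sum>(c, vs)\<leftarrow>zs. norm c * prod_list (map p vs))"
    "x = (\<Sum>(c, vs)\<leftarrow>zs. tensor_scale c (elem_tensor vs))"
  using assms by (auto simp: rep_costs_def)

lemma rep_costs_elem: "length vs = n \<Longrightarrow> prod_list (map p vs) \<in> rep_costs p n (elem_tensor vs)"
  using rep_costsI[of "[(1, vs)]" n p] by simp

lemma rep_costs_zero: "0 \<in> rep_costs p n 0"
  using rep_costsI[of "[]" n p] by simp

lemma rep_costs_add:
  assumes "s \<in> rep_costs p n x" "t \<in> rep_costs p n y" shows "s + t \<in> rep_costs p n (x + y)"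
proof -
  obtain zs zs' where "\<forall>(c, vs)\<in>set zs. length vs = n" "\<forall>(c, vs)\<in>set zs'. length vs = n"
    "s = (\<Sum>(c, vs)\<leftarrow>zs. norm c * prod_list (map p vs))" "t = (\<Sum>(c, vs)\<leftarrow>zs'. norm c * prod_list (map p vs))"
    "x = (\<Sum>(c, vs)\<leftarrow>zs. tensor_scale c (elem_tensor vs))" "y = (\<Sum>(c, vs)\<leftarrow>zs'. tensor_scale c (elem_tensor vs))"
    using assms by (metis rep_costsE)
  then show ?thesis using rep_costsI[of "zs @ zs'" n p] by auto
qed

lemma rep_costs_scale:
  assumes "s \<in> rep_costs p n x" shows "norm c * s \<in> rep_costs p n (tensor_scale c x)"
proof -
  obtain zs where zs: "\<forall>(c, vs)\<in>set zs. length vs = n"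
    "s = (\<Sum>(c, vs)\<leftarrow>zs. norm c * prod_list (map p vs))"
    "x = (\<Sum>(c, vs)\<leftarrow>zs. tensor_scale c (elem_tensor vs))"
    using assms by (rule rep_costsE)
  define zs' where "zs' = map (\<lambda>(a, vs). (c * a, vs)) zs"
  have "(\<Sum>(c, vs)\<leftarrow>zs'. norm c * prod_list (map p vs)) = norm c * s"
    unfolding zs'_def zs(2) by (induction zs) (auto simp: norm_mult algebra_simps)
  moreover have "(\<Sum>(c, vs)\<leftarrow>zs'. tensor_scale c (elem_tensor vs)) = tensor_scale c x"
    unfolding zs'_def zs(3)
    by (induction zs) (simp_all only: list.map sum_list.Nil sum_list.Cons split_beta fst_conv snd_conv
      tensor.scale_zero_right tensor.scale_right_distrib tensor.scale_scale)
  moreover have "\<forall>(c, vs)\<in>set zs'. length vs = n" using zs(1) by (auto simp: zs'_def)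
  ultimately show ?thesis using rep_costsI[of zs' n p] by simp
qed

lemma rep_costs_sum:
  assumes "\<And>a. a \<in> A \<Longrightarrow> s a \<in> rep_costs p n (x a)"
  shows "(\<Sum>a\<in>A. s a) \<in> rep_costs p n (\<Sum>a\<in>A. x a)"
  using assms by (induction A rule: infinite_finite_induct) (auto simp: rep_costs_zero intro: rep_costs_add)

lemma rep_costs_nonneg: "(\<And>v. 0 \<le> p v) \<Longrightarrow> s \<in> rep_costs p n x \<Longrightarrow> 0 \<le> s"
  by (elim rep_costsE) (auto intro!: sum_list_nonneg mult_nonneg_nonneg prod_list_nonneg)

lemma rep_costs_map:
  assumes add: "\<And>x y. L (x + y) = L x + L y" and scale: "\<And>c x. L (tensor_scale c x) = tensor_scale c (L x)"
    and elem: "\<And>vs. length vs = n \<Longrightarrow> \<exists>s\<in>rep_costs q m (L (elem_tensor vs)). s \<le> K * prod_list (map p vs)"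
    and x: "t \<in> rep_costs p n x"
  shows "\<exists>s\<in>rep_costs q m (L x). s \<le> K * t"
proof -
  obtain zs where zs: "\<forall>(c, vs)\<in>set zs. length vs = n"
    "t = (\<Sum>(c, vs)\<leftarrow>zs. norm c * prod_list (map p vs))"
    "x = (\<Sum>(c, vs)\<leftarrow>zs. tensor_scale c (elem_tensor vs))"
    using x by (rule rep_costsE)
  show ?thesis unfolding zs(2,3) using zs(1)
  proof (induction zs)
    case Nil
    have "L 0 = 0" using add[of 0 0] by simp
    then show ?case
      by (intro bexI[of _ 0]) (simp_all only: list.map sum_list.Nil rep_costs_zero mult_zero_right order_refl)
  next
    case (Cons z zs)
    obtain c vs where z: "z = (c, vs)" "length vs = n" using Cons.prems by (cases z) auto
    obtain s where s: "s \<in> rep_costs q m (L (\<Sum>(c, vs)\<leftarrow>zs. tensor_scale c (elem_tensor vs)))"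
      "s \<le> K * (\<Sum>(c, vs)\<leftarrow>zs. norm c * prod_list (map p vs))" using Cons by auto
    obtain r where r: "r \<in> rep_costs q m (L (elem_tensor vs))" "r \<le> K * prod_list (map p vs)"
      using elem[OF z(2)] by auto
    have "norm c * r + s \<in> rep_costs q m (L (\<Sum>(c, vs)\<leftarrow>z # zs. tensor_scale c (elem_tensor vs)))"
      using rep_costs_add[OF rep_costs_scale[OF r(1), of c] s(1)]
      by (simp only: z(1) list.map sum_list.Cons prod.case add scale)
    moreover have "norm c * r + s \<le> K * (\<Sum>(c, vs)\<leftarrow>z # zs. norm c * prod_list (map p vs))"
      using mult_left_mono[OF r(2), of "norm c"] s(2) by (simp add: z(1) algebra_simps)
    ultimately show ?case by blast
  qed
qed

lemma tensor_power_subspace: "tensor.subspace (tensor_power n)"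
  unfolding tensor_power_def by (rule tensor.subspace_span)

lemma elem_in_tensor_power: "length vs = n \<Longrightarrow> elem_tensor vs \<in> tensor_power n"
  unfolding tensor_power_def by (rule tensor.span_base) auto

lemma rep_costs_nonempty: "x \<in> tensor_power n \<Longrightarrow> rep_costs p n x \<noteq> {}"
proof -
  assume "x \<in> tensor_power n"
  then have "\<exists>s. s \<in> rep_costs p n x"
    unfolding tensor_power_def
  proof (induction rule: tensor.span_induct)
    case base
    show ?case
      by (auto simp: tensor.subspace_def intro: rep_costs_zero rep_costs_add rep_costs_scale)
  next
    case (step x)
    then show ?case using rep_costs_elem by auto
  qed
  then show ?thesis by auto
qed

lemma tensor_power_map:
  assumes "\<And>x y. L (x + y) = L x + L y" "\<And>c x. L (tensor_scale c x) = tensor_scale c (L x)"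
    and elem: "\<And>vs. length vs = n \<Longrightarrow> L (elem_tensor vs) \<in> tensor_power m" and x: "x \<in> tensor_power n"
  shows "L x \<in> tensor_power m"
proof -
  have "L 0 = 0" using assms(1)[of 0 0] by simp
  then have "tensor.subspace {x. L x \<in> tensor_power m}"
    using tensor_power_subspace[of m] assms(1,2) by (simp add: tensor.subspace_def)
  moreover have "elem_tensor ` {vs. length vs = n} \<subseteq> {x. L x \<in> tensor_power m}" using elem by auto
  ultimately show ?thesis using x tensor.span_minimal unfolding tensor_power_def[of n] by blast
qed

lemma proj_seminorm_le:
  assumes "continuous_seminorm p" "s \<in> rep_costs p n x"
  shows "proj_seminorm p n x \<le> s"
  unfolding proj_seminorm_eq using assms rep_costs_nonneg[OF continuous_seminorm_nonneg]
  by (intro cInf_lower bdd_belowI[of _ 0])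

lemma proj_seminorm_greatest:
  assumes "x \<in> tensor_power n" "\<And>s. s \<in> rep_costs p n x \<Longrightarrow> m \<le> s"
  shows "m \<le> proj_seminorm p n x"
  unfolding proj_seminorm_eq using assms rep_costs_nonempty by (intro cInf_greatest) auto

lemma proj_seminorm_nonneg:
  "continuous_seminorm p \<Longrightarrow> x \<in> tensor_power n \<Longrightarrow> 0 \<le> proj_seminorm p n x"
  using rep_costs_nonneg[OF continuous_seminorm_nonneg] by (intro proj_seminorm_greatest)

lemma proj_seminorm_zero: "continuous_seminorm p \<Longrightarrow> proj_seminorm p n 0 = 0"
  using proj_seminorm_nonneg[of p 0 n] proj_seminorm_le[OF _ rep_costs_zero[of p n]]
    tensor.subspace_0[OF tensor_power_subspace, of n] by force

lemma proj_seminorm_triangle: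
  assumes p: "continuous_seminorm p" and x: "x \<in> tensor_power n" and y: "y \<in> tensor_power n"
  shows "proj_seminorm p n (x + y) \<le> proj_seminorm p n x + proj_seminorm p n y"
proof -
  have "proj_seminorm p n (x + y) - t \<le> s" if "s \<in> rep_costs p n x" "t \<in> rep_costs p n y" for s t
    using proj_seminorm_le[OF p rep_costs_add[OF that]] by simp
  then have "proj_seminorm p n (x + y) - t \<le> proj_seminorm p n x" if "t \<in> rep_costs p n y" for t
    using that by (intro proj_seminorm_greatest x) auto
  then have "proj_seminorm p n (x + y) - proj_seminorm p n x \<le> proj_seminorm p n y"
    by (intro proj_seminorm_greatest y) (simp add: algebra_simps)
  then show ?thesis by simp
qed

lemma proj_seminorm_scale:
  assumes p: "continuous_seminorm p" and x: "x \<in> tensor_power n"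
  shows "proj_seminorm p n (tensor_scale c x) = norm c * proj_seminorm p n x"
proof (cases "c = 0")
  case True
  then show ?thesis using proj_seminorm_zero[OF p] by simp
next
  case False
  have le: "proj_seminorm p n (tensor_scale c x) \<le> norm c * proj_seminorm p n x"
    if x: "x \<in> tensor_power n" and c: "c \<noteq> 0" for c x
  proof -
    have "proj_seminorm p n (tensor_scale c x) / norm c \<le> proj_seminorm p n x"
      using proj_seminorm_le[OF p rep_costs_scale] c
      by (intro proj_seminorm_greatest x) (simp add: field_simps)
    then show ?thesis using c by (simp add: field_simps)
  qed
  have "proj_seminorm p n (tensor_scale (1 / c) (tensor_scale c x))
      \<le> norm (1 / c) * proj_seminorm p n (tensor_scale c x)"
    using False x tensor.subspace_scale[OF tensor_power_subspace] by (intro le) auto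
  then have "norm c * proj_seminorm p n x \<le> proj_seminorm p n (tensor_scale c x)"
    using False by (simp add: norm_divide field_simps)
  with le[OF x False] show ?thesis by simp
qed


section \<open>Powers in the symmetric algebra\<close>

lemma perm_act_add: "perm_act n \<sigma> (x + y) = perm_act n \<sigma> x + perm_act n \<sigma> y"
  by (simp add: perm_act_def fun_eq_iff)

lemma perm_act_scale: "perm_act n \<sigma> (tensor_scale c x) = tensor_scale c (perm_act n \<sigma> x)"
  by (simp add: perm_act_def fun_eq_iff tensor_scale_def)

lemma symmetrize_add: "symmetrize n (x + y) = symmetrize n x + symmetrize n y"
  by (simp add: symmetrize_def perm_act_add sum.distrib tensor.scale_right_distrib)

lemma symmetrize_scale: "symmetrize n (tensor_scale c x) = tensor_scale c (symmetrize n x)"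
  by (simp add: symmetrize_def perm_act_scale tensor.scale_sum_right[symmetric] mult.commute)

lemma tensor_mult_add: "tensor_mult m n (x + y) z = tensor_mult m n x z + tensor_mult m n y z"
  by (simp add: tensor_mult_def fun_eq_iff)

lemma tensor_mult_scale: "tensor_mult m n (tensor_scale c x) z = tensor_scale c (tensor_mult m n x z)"
  by (simp add: tensor_mult_def fun_eq_iff tensor_scale_def)

lemma tensor_mult_single:
  "length vs = n \<Longrightarrow> tensor_mult n 1 (elem_tensor vs) (elem_tensor [v]) = elem_tensor (vs @ [v])"
  using tensor_mult_elem[of vs "[v]"] by simp

lemma koszul_sign_norm: "norm (koszul_sign n \<sigma> od) = 1"
  by (simp add: koszul_sign_def norm_power)

lemma perm_elem_in_tensor_power: "perm_elem n \<sigma> vs \<in> tensor_power n"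
  unfolding perm_elem_def
  by (intro tensor.subspace_sum tensor.subspace_scale tensor_power_subspace elem_in_tensor_power) simp

lemma symmetrize_in_tensor_power:
  assumes "x \<in> tensor_power n" shows "symmetrize n x \<in> tensor_power n"
proof -
  have "perm_act n \<sigma> x \<in> tensor_power n" if "\<sigma> permutes {..<n}" for \<sigma>
    using assms by (rule tensor_power_map[where L = "perm_act n \<sigma>", rotated -1])
      (auto simp: perm_act_add perm_act_scale perm_act_elem[OF _ that] perm_elem_in_tensor_power)
  then show ?thesis unfolding symmetrize_def
    by (intro tensor.subspace_sum tensor.subspace_scale tensor_power_subspace) auto
qed

lemma sym_power_in_tensor_power: "x \<in> sym_power n \<Longrightarrow> x \<in> tensor_power n"
  by (auto simp: sym_power_def symmetrize_in_tensor_power)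

lemma sym_power_subspace: "tensor.subspace (sym_power n)"
proof -
  have "symmetrize n 0 = 0" using symmetrize_add[of n 0 0] by simp
  then show ?thesis
    using tensor_power_subspace[of n]
    unfolding tensor.subspace_def sym_power_def
    by (auto simp: symmetrize_add[symmetric] symmetrize_scale[symmetric])
qed

text \<open>
  A seminorm of this form is additive over the homogeneous components of a vector, so symmetrizing
  does not increase its projective powers; every seminorm \<open>p\<close> is dominated by it.
\<close>

definition graded_seminorm :: "('v \<Rightarrow> real) \<Rightarrow> 'v \<Rightarrow> real" where
  "graded_seminorm p v = p (even_part v) + p (odd_part v)"

lemma part_sum: "even_part v + odd_part v = v"
proof -
  obtain x y where "v = x + y" "x \<in> V0" "y \<in> V1" using sum_UNIV by metis
  then show ?thesis using decompose by simp
qed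

lemma part_part: "part b (part c v) = (if b = c then part c v else 0)"
proof (rule part_homogeneous)
  obtain x y where "v = x + y" "x \<in> V0" "y \<in> V1" using sum_UNIV by metis
  then show "part c v \<in> (if c then V1 else V0)" using decompose by (simp add: part_def)
qed

lemma graded_seminorm_part:
  assumes "p 0 = 0" shows "graded_seminorm p (part b v) = p (part b v)"
  using part_part[of False b v] part_part[of True b v] assms
  by (cases b) (simp_all add: graded_seminorm_def part_def)

lemma continuous_graded_seminorm:
  assumes p: "continuous_seminorm p" shows "continuous_seminorm (graded_seminorm p)"
proof -
  have cont: "continuous_on UNIV even_part" "continuous_on UNIV odd_part"
    using continuous_even continuous_odd by (simp_all add: even_part_def[abs_def] odd_part_def[abs_def])
  have pc: "continuous_on UNIV p" and tri: "\<And>x y. p (x + y) \<le> p x + p y"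
    and sc: "\<And>c x. p (scale c x) = norm c * p x" using p by (auto simp: continuous_seminorm_def)
  have lin: "even_part (x + y) = even_part x + even_part y" "even_part (scale c x) = scale c (even_part x)"
    "odd_part (x + y) = odd_part x + odd_part y" "odd_part (scale c x) = scale c (odd_part x)" for x y c
    using linear_part[of False] linear_part[of True] by (auto simp: Vector_Spaces.linear_iff part_def)
  have "graded_seminorm p (x + y) \<le> graded_seminorm p x + graded_seminorm p y" for x y
    using tri[of "even_part x" "even_part y"] tri[of "odd_part x" "odd_part y"]
    by (simp add: graded_seminorm_def lin)
  moreover have "continuous_on UNIV (graded_seminorm p)"
    unfolding graded_seminorm_def[abs_def]
    by (intro continuous_intros continuous_on_compose2[OF pc] cont) auto
  ultimately show ?thesis
    by (simp add: continuous_seminorm_def graded_seminorm_def lin sc algebra_simps)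
qed

lemma le_graded_seminorm: "continuous_seminorm p \<Longrightarrow> p v \<le> graded_seminorm p v"
  unfolding graded_seminorm_def by (metis continuous_seminorm_def part_sum)

lemma sum_bool_lists:
  "(\<Sum>e | length e = n. \<Prod>j<n. h (e ! j) j) = (\<Prod>j<n. h False j + h True j :: real)"
proof (induction n arbitrary: h)
  case (Suc n)
  let ?L = "{e :: bool list. length e = n}"
  have fin: "finite ?L" using finite_lists_length_eq[of "UNIV :: bool set" n] by simp
  have "{e :: bool list. length e = Suc n} = (#) False ` ?L \<union> (#) True ` ?L"
    by (auto simp: length_Suc_conv image_iff)
  moreover have "(#) False ` ?L \<inter> (#) True ` ?L = {}" by auto
  ultimately have "(\<Sum>e | length e = Suc n. \<Prod>j<Suc n. h (e ! j) j) =
    (\<Sum>e\<in>(#) False ` ?L. \<Prod>j<Suc n. h (e ! j) j) + (\<Sum>e\<in>(#) True ` ?L. \<Prod>j<Suc n. h (e ! j) j)"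
    using fin by (simp only: sum.union_disjoint finite_imageI)
  also have "\<dots> = (\<Sum>e\<in>?L. \<Prod>j<Suc n. h ((False # e) ! j) j) + (\<Sum>e\<in>?L. \<Prod>j<Suc n. h ((True # e) ! j) j)"
    by (simp add: sum.reindex del: prod.lessThan_Suc)
  also have "\<dots> = (h False 0 + h True 0) * (\<Sum>e\<in>?L. \<Prod>j<n. h (e ! j) (Suc j))"
    by (simp add: prod.lessThan_Suc_shift sum_distrib_left sum.distrib algebra_simps del: prod.lessThan_Suc)
  also have "\<dots> = (\<Prod>j<Suc n. h False j + h True j)"
    by (subst Suc.IH) (simp add: prod.lessThan_Suc_shift del: prod.lessThan_Suc)
  finally show ?case .
qed simp

text \<open>
  The \<open>2\<^sup>n\<close> terms of the expansion into homogeneous components cost together as much as the single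
  elementary tensor one started from.
\<close>

lemma perm_elem_cost:
  assumes p0: "p 0 = 0" and vs: "length vs = n" and \<sigma>: "\<sigma> permutes {..<n}"
  shows "prod_list (map (graded_seminorm p) vs) \<in> rep_costs (graded_seminorm p) n (perm_elem n \<sigma> vs)"
proof -
  let ?q = "graded_seminorm p"
  let ?c = "\<lambda>e. norm (koszul_sign n \<sigma> (\<lambda>j. e ! j)) *
    prod_list (map ?q (map (\<lambda>i. part (e ! \<sigma> i) (vs ! \<sigma> i)) [0..<n]))"
  have c: "?c e = (\<Prod>j<n. p (part (e ! j) (vs ! j)))" for e
  proof -
    have "?c e = (\<Prod>i<n. p (part (e ! \<sigma> i) (vs ! \<sigma> i)))"
      by (simp add: koszul_sign_norm comp_def graded_seminorm_part[where p = p, OF p0]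
        interv_sum_list_conv_sum_set_nat prod.list_conv_set_nth atLeast0LessThan)
    also have "\<dots> = (\<Prod>j<n. p (part (e ! j) (vs ! j)))"
      using prod.permute[OF \<sigma>, of "\<lambda>j. p (part (e ! j) (vs ! j))"] by (simp add: comp_def)
    finally show ?thesis .
  qed
  have "(\<Sum>e | length e = n. ?c e) \<in> rep_costs ?q n (perm_elem n \<sigma> vs)"
    unfolding perm_elem_def by (intro rep_costs_sum rep_costs_scale rep_costs_elem) simp
  also have "(\<Sum>e | length e = n. ?c e) = (\<Prod>j<n. ?q (vs ! j))"
    unfolding c using sum_bool_lists[where h = "\<lambda>b j. p (part b (vs ! j))" and n = n]
    by (simp add: graded_seminorm_def part_def)
  also have "\<dots> = prod_list (map ?q vs)"
    by (simp add: prod.list_conv_set_nth vs atLeast0LessThan)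
  finally show ?thesis .
qed

lemma symmetrize_cost:
  assumes p0: "p 0 = 0" and x: "t \<in> rep_costs (graded_seminorm p) n x"
  shows "\<exists>s\<in>rep_costs (graded_seminorm p) n (symmetrize n x). s \<le> t"
proof -
  let ?q = "graded_seminorm p" and ?P = "{\<sigma>. \<sigma> permutes {..<n}}"
  have "\<exists>s. s \<in> rep_costs ?q n (perm_act n \<sigma> x) \<and> s \<le> t" if \<sigma>: "\<sigma> permutes {..<n}" for \<sigma>
    using rep_costs_map[where L = "perm_act n \<sigma>" and K = 1 and q = ?q and m = n, OF perm_act_add perm_act_scale _ x]
      perm_elem_cost[where p = p, OF p0 _ \<sigma>] perm_act_elem[OF _ \<sigma>] by fastforce
  then obtain s where s: "\<And>\<sigma>. \<sigma> \<in> ?P \<Longrightarrow> s \<sigma> \<in> rep_costs ?q n (perm_act n \<sigma> x) \<and> s \<sigma> \<le> t"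
    by (metis mem_Collect_eq)
  have "norm (1 / fact n :: 'k) * (\<Sum>\<sigma>\<in>?P. s \<sigma>) \<in> rep_costs ?q n (symmetrize n x)"
    unfolding symmetrize_def using s by (intro rep_costs_scale rep_costs_sum) auto
  moreover have "(\<Sum>\<sigma>\<in>?P. s \<sigma>) \<le> of_nat (card ?P) * t" using s by (intro sum_bounded_above) auto
  then have "norm (1 / fact n :: 'k) * (\<Sum>\<sigma>\<in>?P. s \<sigma>) \<le> t"
    using card_permutations[of "{..<n}" n] by (simp add: norm_divide norm_fact field_simps)
  ultimately show ?thesis by blast
qed

lemma vpow_in_sym_power: "vpow v n \<in> sym_power n"
proof (induction n)
  case 0
  have "symmetrize 0 (elem_tensor []) = elem_tensor []"
    by (simp add: symmetrize_def perm_act_elem permutes_empty perm_elem_def koszul_sign_def)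
  then show ?case unfolding sym_power_def using elem_in_tensor_power[of "[]" 0] by force
next
  case (Suc n)
  have "tensor_mult n 1 (vpow v n) (elem_tensor [v]) \<in> tensor_power (n + 1)"
    by (rule tensor_power_map[where L = "\<lambda>x. tensor_mult n 1 x (elem_tensor [v])",
          OF _ _ _ sym_power_in_tensor_power[OF Suc]])
      (simp_all only: tensor_mult_add tensor_mult_scale tensor_mult_single elem_in_tensor_power length_append_singleton Suc_eq_plus1)
  then show ?case by (simp add: sym_mult_def sym_power_def)
qed

lemma vpow_in_tensor_power: "vpow v n \<in> tensor_power n"
  by (rule sym_power_in_tensor_power[OF vpow_in_sym_power])

text \<open>
  Appending \<open>v\<close> multiplies the cost of a representation by the seminorm of \<open>v\<close>, and symmetrizing
  does not increase it.
\<close>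

lemma vpow_cost:
  assumes p: "continuous_seminorm p"
  shows "\<exists>s\<in>rep_costs (graded_seminorm p) n (vpow v n). s \<le> graded_seminorm p v ^ n"
proof (induction n)
  case 0
  show ?case using rep_costs_elem[of "[]" 0 "graded_seminorm p"] by auto
next
  case (Suc n)
  let ?q = "graded_seminorm p"
  have p0: "p 0 = 0" using p unfolding continuous_seminorm_def by (metis norm_zero mult_zero_left scale_zero_left)
  have q: "0 \<le> ?q v" using continuous_seminorm_nonneg[OF continuous_graded_seminorm[OF p]] .
  obtain t where t: "t \<in> rep_costs ?q n (vpow v n)" "t \<le> ?q v ^ n" using Suc by auto
  have "\<exists>s\<in>rep_costs ?q (n + 1) (tensor_mult n 1 (elem_tensor vs) (elem_tensor [v])). s \<le> ?q v * prod_list (map ?q vs)"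
    if "length vs = n" for vs
    using rep_costs_elem[of "vs @ [v]" "n + 1" ?q] that
    by (intro bexI[of _ "prod_list (map ?q (vs @ [v]))"]) (simp_all only: tensor_mult_single, simp_all)
  then obtain s where s: "s \<in> rep_costs ?q (n + 1) (tensor_mult n 1 (vpow v n) (elem_tensor [v]))" "s \<le> ?q v * t"
    using rep_costs_map[where L = "\<lambda>x. tensor_mult n 1 x (elem_tensor [v])", OF tensor_mult_add tensor_mult_scale _ t(1)]
    by blast
  obtain r where "r \<in> rep_costs ?q (n + 1) (vpow v (Suc n))" "r \<le> s"
    using symmetrize_cost[OF p0 s(1)] by (auto simp: sym_mult_def)
  moreover have "s \<le> ?q v ^ Suc n"
    using s(2) mult_left_mono[OF t(2) q] by simp
  ultimately show ?case by (intro bexI[of _ r]) auto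
qed

lemma proj_seminorm_vpow_le:
  assumes p: "continuous_seminorm p"
  shows "proj_seminorm p n (vpow v n) \<le> graded_seminorm p v ^ n"
proof -
  let ?q = "graded_seminorm p"
  obtain t where t: "t \<in> rep_costs ?q n (vpow v n)" "t \<le> ?q v ^ n" using vpow_cost[OF p] by blast
  have "prod_list (map p vs) \<le> prod_list (map ?q vs)" for vs
  proof (induction vs)
    case (Cons w vs)
    then show ?case
      using le_graded_seminorm[OF p, of w] continuous_seminorm_nonneg[OF p]
        continuous_seminorm_nonneg[OF continuous_graded_seminorm[OF p]]
      by (auto intro!: mult_mono prod_list_nonneg)
  qed simp
  then obtain s where "s \<in> rep_costs p n (vpow v n)" "s \<le> t"
    using rep_costs_map[where L = "\<lambda>x. x" and K = 1 and q = p and m = n, OF _ _ _ t(1)] rep_costs_elem[of _ n p] by fastforce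
  then show ?thesis using proj_seminorm_le[OF p] t(2) by fastforce
qed

lemma elem_tensor_snoc_scale: "elem_tensor (vs @ [scale t v]) = tensor_scale t (elem_tensor (vs @ [v]))"
proof
  fix f
  let ?n = "length vs"
  show "elem_tensor (vs @ [scale t v]) f = tensor_scale t (elem_tensor (vs @ [v])) f"
  proof (cases "multilinear (?n + 1) f")
    case True
    from True[unfolded multilinear_def, rule_format, of "vs @ [v]" ?n]
    have "Vector_Spaces.linear scale (*) (\<lambda>x. f (vs @ [x]))" by simp
    then show ?thesis using True by (simp add: Vector_Spaces.linear_iff elem_tensor_def tensor_scale_def)
  qed (simp add: elem_tensor_def tensor_scale_def)
qed

lemma vpow_scale: "vpow (scale t v) n = tensor_scale (t ^ n) (vpow v n)"
proof (induction n)
  case (Suc n)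
  have *: "tensor_mult n 1 x (elem_tensor [scale t v]) = tensor_scale t (tensor_mult n 1 x (elem_tensor [v]))"
    if "x \<in> tensor_power n" for x
    using that unfolding tensor_power_def
  proof (induction rule: tensor.span_induct)
    case base
    have "tensor_mult n 1 0 z = 0" for z by (simp add: tensor_mult_def fun_eq_iff)
    then show ?case
      by (simp add: tensor.subspace_def tensor_mult_add tensor_mult_scale tensor.scale_right_distrib
          tensor.scale_left_commute del: One_nat_def)
  next
    case (step x)
    then show ?case by (auto simp: tensor_mult_single elem_tensor_snoc_scale simp del: One_nat_def)
  qed
  show ?case
    using *[OF vpow_in_tensor_power, of v] unfolding vpow.simps sym_mult_def Suc.IH tensor_mult_scale symmetrize_scale
    by (simp add: symmetrize_scale mult.commute)
qed simp

text \<open>Permutations of even vectors carry no sign, so \<open>v \<otimes> \<dots> \<otimes> v\<close> is already symmetric.\<close>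

lemma vpow_even:
  assumes "v \<in> V0" shows "vpow v n = elem_tensor (replicate n v)"
proof (induction n)
  case (Suc n)
  let ?w = "elem_tensor (replicate (n + 1) v)"
  have "perm_act (n + 1) \<sigma> ?w = ?w" if \<sigma>: "\<sigma> permutes {..<n + 1}" for \<sigma>
  proof -
    have "map (\<lambda>i. replicate (n + 1) v ! \<sigma> i) [0..<n + 1] = replicate (n + 1) v"
      using permutes_in_image[OF \<sigma>] by (intro nth_equalityI) (auto simp del: upt_Suc replicate_Suc)
    moreover have "koszul_sign (n + 1) \<sigma> (\<lambda>j. replicate (n + 1) False ! j) = 1"
    proof -
      have "{(i, j). i < j \<and> j < n + 1 \<and> \<sigma> i > \<sigma> j \<and> replicate (n + 1) False ! \<sigma> i \<and> replicate (n + 1) False ! \<sigma> j} = {}"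
        using permutes_in_image[OF \<sigma>] by (auto simp del: replicate_Suc)
      then show ?thesis unfolding koszul_sign_def by (simp only: card.empty power_0)
    qed
    ultimately show ?thesis
      using perm_elem_homogeneous[of "replicate (n + 1) v" "n + 1" "replicate (n + 1) False" \<sigma>] \<sigma> assms
        perm_act_elem[of "replicate (n + 1) v" "n + 1" \<sigma>]
      by (simp del: replicate_Suc upt_Suc)
  qed
  then have "symmetrize (n + 1) ?w = tensor_scale (1 / fact (n + 1)) (\<Sum>\<sigma> | \<sigma> permutes {..<n + 1}. ?w)"
    unfolding symmetrize_def by (intro arg_cong[where f = "tensor_scale _"] sum.cong) auto
  also have "(\<Sum>\<sigma> | \<sigma> permutes {..<n + 1}. ?w) = tensor_scale (of_nat (card {\<sigma>. \<sigma> permutes {..<n + 1}})) ?w"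
    by (rule tensor.sum_constant_scale)
  also have "card {\<sigma>. \<sigma> permutes {..<n + 1}} = fact (n + 1)" by (rule card_permutations) auto
  also have "tensor_scale (1 / fact (n + 1)) (tensor_scale (of_nat (fact (n + 1))) ?w) = ?w"
    by (simp del: fact_Suc)
  finally have "symmetrize (n + 1) ?w = ?w" .
  moreover have "tensor_mult n 1 (elem_tensor (replicate n v)) (elem_tensor [v]) = ?w"
    using tensor_mult_single[of "replicate n v" n v] by (simp add: replicate_append_same)
  ultimately show ?case by (simp add: sym_mult_def Suc.IH)
qed simp

text \<open>
  Evaluating a tensor on the \<open>n\<close>-linear form \<open>v\<^sub>1, \<dots>, v\<^sub>n \<mapsto> \<phi> v\<^sub>1 \<cdots> \<phi> v\<^sub>n\<close> bounds the cost
  of its representations from below.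
\<close>

lemma proj_seminorm_replicate_ge:
  assumes \<phi>: "Vector_Spaces.linear scale (*) \<phi>"
  shows "norm (\<phi> v) ^ n \<le> proj_seminorm (\<lambda>x. norm (\<phi> x)) n (elem_tensor (replicate n v))"
proof (rule proj_seminorm_greatest)
  let ?f = "\<lambda>vs. prod_list (map \<phi> vs)"
  have f: "multilinear n ?f"
    unfolding multilinear_def
  proof (intro allI impI)
    fix vs :: "'v list" and i assume i: "length vs = n" "i < n"
    have "?f (vs[i := x]) = (prod_list (map \<phi> (take i vs)) * prod_list (map \<phi> (drop (Suc i) vs))) * \<phi> x" for x
      using i by (simp add: upd_conv_take_nth_drop mult_ac)
    then show "Vector_Spaces.linear scale (*) (\<lambda>x. ?f (vs[i := x]))"
      using \<phi> by (simp add: Vector_Spaces.linear_iff algebra_simps)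
  qed
  fix s assume "s \<in> rep_costs (\<lambda>x. norm (\<phi> x)) n (elem_tensor (replicate n v))"
  then obtain zs where zs: "\<forall>(c, vs)\<in>set zs. length vs = n"
    "s = (\<Sum>(c, vs)\<leftarrow>zs. norm c * prod_list (map (\<lambda>x. norm (\<phi> x)) vs))"
    "elem_tensor (replicate n v) = (\<Sum>(c, vs)\<leftarrow>zs. tensor_scale c (elem_tensor vs))"
    by (rule rep_costsE)
  have n: "norm (?f vs) = prod_list (map (\<lambda>x. norm (\<phi> x)) vs)" for vs
    by (induction vs) (auto simp: norm_mult)
  have "norm ((\<Sum>(c, vs)\<leftarrow>zs. tensor_scale c (elem_tensor vs)) ?f) \<le> s"
    unfolding zs(2) using zs(1)
  proof (induction zs)
    case (Cons z zs)
    obtain c vs where z: "z = (c, vs)" "length vs = n" using Cons.prems by (cases z) auto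
    have "norm (tensor_scale c (elem_tensor vs) ?f) = norm c * prod_list (map (\<lambda>x. norm (\<phi> x)) vs)"
      using f z by (simp add: tensor_scale_def elem_tensor_def norm_mult n)
    then show ?case using Cons by (auto simp: z intro: order_trans[OF norm_triangle_ineq])
  qed simp
  moreover have "elem_tensor (replicate n v) ?f = \<phi> v ^ n" using f by (simp add: elem_tensor_def)
  ultimately show "norm (\<phi> v) ^ n \<le> s" unfolding zs(3)[symmetric] by (simp add: norm_power)
qed (simp add: elem_in_tensor_power)

end


section \<open>Bounds for binomial expansions\<close>

lemma binomial_sum_lessThan:
  fixes a b :: "'a::comm_ring_1"
  assumes "n < N" shows "(\<Sum>k<N. of_nat (n choose k) * a ^ k * b ^ (n - k)) = (a + b) ^ n"
proof -
  have "(\<Sum>k<N. of_nat (n choose k) * a ^ k * b ^ (n - k)) = (\<Sum>k\<le>n. of_nat (n choose k) * a ^ k * b ^ (n - k))"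
    using assms by (intro sum.mono_neutral_right) (auto simp: binomial_eq_0)
  then show ?thesis by (simp add: binomial_ring)
qed

lemma binomial_term_le:
  fixes a b :: real
  assumes "0 \<le> a" "0 \<le> b" shows "of_nat (n choose k) * a ^ k * b ^ (n - k) \<le> (a + b) ^ n"
  unfolding binomial_sum_lessThan[of n "n + k + 1", symmetric, simplified]
  by (rule member_le_sum[of k "{..<n + k + 1}" "\<lambda>k. of_nat (n choose k) * a ^ k * b ^ (n - k)", simplified])
     (use assms in auto)

text \<open>
  Doubling \<open>a\<close> turns the tail of a binomial expansion into a multiple \<open>2\<^sup>-\<^sup>N\<close> of the full
  expansion. Thus tails are bounded by the same kind of expression as full sums.
\<close>

lemma binomial_tail_le:
  fixes a b :: "'a::real_normed_field"
  shows "norm ((\<Sum>k<N. of_nat (n choose k) * a ^ k * b ^ (n - k)) - (a + b) ^ n)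
    \<le> (1 / 2) ^ N * (2 * norm a + norm b) ^ n"
proof -
  let ?M = "N + n + 1"
  define S T where "S = (\<Sum>k<N. of_nat (n choose k) * a ^ k * b ^ (n - k))"
    and "T = (\<Sum>k=N..<?M. of_nat (n choose k) * a ^ k * b ^ (n - k))"
  have split: "{..<?M} = {..<N} \<union> {N..<?M}" by auto
  have "(a + b) ^ n = (\<Sum>k<?M. of_nat (n choose k) * a ^ k * b ^ (n - k))"
    by (rule binomial_sum_lessThan[symmetric]) simp
  also have "\<dots> = S + T"
    unfolding split S_def T_def by (rule sum.union_disjoint) auto
  finally have "norm (S - (a + b) ^ n) = norm T" by simp
  also have "norm T \<le> (\<Sum>k=N..<?M. (1 / 2) ^ N * (of_nat (n choose k) * (2 * norm a) ^ k * norm b ^ (n - k)))"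
    unfolding T_def
  proof (rule sum_norm_le)
    fix k assume "k \<in> {N..<?M}"
    then have "(2::real) ^ N \<le> 2 ^ k" by (intro power_increasing) auto
    then have "1 \<le> (1 / 2) ^ N * (2 ^ k :: real)" by (simp add: field_simps)
    then have "of_nat (n choose k) * norm a ^ k * norm b ^ (n - k) * 1 \<le>
        of_nat (n choose k) * norm a ^ k * norm b ^ (n - k) * ((1 / 2) ^ N * (2 ^ k :: real))"
      by (intro mult_left_mono) auto
    then show "norm (of_nat (n choose k) * a ^ k * b ^ (n - k))
        \<le> (1 / 2) ^ N * (of_nat (n choose k) * (2 * norm a) ^ k * norm b ^ (n - k))"
      by (simp add: norm_mult norm_power power_mult_distrib mult_ac)
  qed
  also have "\<dots> \<le> (\<Sum>k<?M. (1 / 2) ^ N * (of_nat (n choose k) * (2 * norm a) ^ k * norm b ^ (n - k)))"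
    by (rule sum_mono2) auto
  also have "\<dots> = (1 / 2) ^ N * (2 * norm a + norm b) ^ n"
    unfolding sum_distrib_left[symmetric] by (subst binomial_sum_lessThan) auto
  finally show ?thesis unfolding S_def .
qed

text \<open>
  The induction needs the exact second-order remainder of \<open>(\<bar>t\<bar> + 1)\<^sup>m\<close>, since it satisfies the same
  recursion in \<open>m\<close> as the left-hand side.
\<close>

lemma power_remainder_le:
  fixes t h :: "'a::real_normed_field"
  assumes "norm h \<le> 1"
  shows "norm ((t + h) ^ m - t ^ m - h * (of_nat m * t ^ (m - 1)))
    \<le> (norm h)\<^sup>2 * ((norm t + 1) ^ m - norm t ^ m - of_nat m * norm t ^ (m - 1))"
proof (induction m)
  case (Suc m)
  define r \<rho> where "r = (t + h) ^ m - t ^ m - h * (of_nat m * t ^ (m - 1))"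
    and "\<rho> = (norm t + 1) ^ m - norm t ^ m - of_nat m * norm t ^ (m - 1)"
  have m: "of_nat m * x ^ (m - 1) * x = of_nat m * x ^ m" for x :: "'b::comm_ring_1"
    by (cases m) auto
  have r: "(t + h) ^ Suc m - t ^ Suc m - h * (of_nat (Suc m) * t ^ (Suc m - 1)) = (t + h) * r + h\<^sup>2 * (of_nat m * t ^ (m - 1))"
    using m[of t] unfolding r_def by (simp add: algebra_simps power2_eq_square)
  have \<rho>: "(norm t + 1) ^ Suc m - norm t ^ Suc m - of_nat (Suc m) * norm t ^ (Suc m - 1) = (norm t + 1) * \<rho> + of_nat m * norm t ^ (m - 1)"
    using m[of "norm t"] unfolding \<rho>_def by (simp add: algebra_simps)
  have "norm ((t + h) * r) \<le> (norm t + 1) * ((norm h)\<^sup>2 * \<rho>)"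
    unfolding norm_mult using Suc assms
    by (intro mult_mono order_trans[OF norm_triangle_ineq]) (auto simp: r_def \<rho>_def)
  then show ?case unfolding r \<rho>
    by (intro order_trans[OF norm_triangle_ineq]) (simp add: norm_mult norm_power algebra_simps)
qed simp

lemma difference_quotient_power_le:
  fixes t h :: "'a::real_normed_field"
  assumes h: "norm h \<le> 1" "h \<noteq> 0"
  shows "norm (((t + h) ^ m - t ^ m) / h - of_nat m * t ^ (m - 1)) \<le> norm h * (norm t + 1) ^ m"
proof -
  have *: "h * (x / h - y) = x - h * y" for x y using h by (simp add: right_diff_distrib)
  have "norm h * norm (((t + h) ^ m - t ^ m) / h - of_nat m * t ^ (m - 1))
      = norm ((t + h) ^ m - t ^ m - h * (of_nat m * t ^ (m - 1)))"
    by (simp only: norm_mult[symmetric] *)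
  also have "\<dots> \<le> (norm h)\<^sup>2 * ((norm t + 1) ^ m - norm t ^ m - of_nat m * norm t ^ (m - 1))"
    by (rule power_remainder_le[OF h(1)])
  also have "\<dots> \<le> (norm h)\<^sup>2 * (norm t + 1) ^ m"
  proof (rule mult_left_mono)
    have "0 \<le> norm t ^ m" "0 \<le> of_nat m * norm t ^ (m - 1)" by simp_all
    then show "(norm t + 1) ^ m - norm t ^ m - of_nat m * norm t ^ (m - 1) \<le> (norm t + 1) ^ m" by linarith
  qed simp
  also have "\<dots> = norm h * (norm h * (norm t + 1) ^ m)" by (simp add: power2_eq_square)
  finally show ?thesis using h by simp
qed

lemma summable_power_fact_powr:
  fixes R x :: real
  assumes R: "R < 1" and x: "0 \<le> x"
  shows "summable (\<lambda>n. x ^ n / fact n * fact n powr R)"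
proof -
  let ?f = "\<lambda>n. x ^ n / fact n * fact n powr R"
  \<comment> \<open>The quotient of successive terms tends to 0 because \<open>R - 1 < 0\<close>.\<close>
  have step: "?f (Suc n) = x * real (Suc n) powr (R - 1) * ?f n" for n
  proof -
    have "real (Suc n) powr (R - 1) * real (Suc n) = real (Suc n) powr R" by (simp add: powr_diff)
    then show ?thesis by (simp add: powr_mult field_simps del: of_nat_Suc)
  qed
  have "(\<lambda>n. x * real (Suc n) powr (R - 1)) \<longlonglongrightarrow> x * 0"
    using R by (intro tendsto_mult tendsto_const tendsto_neg_powr
      filterlim_compose[OF filterlim_real_sequentially filterlim_Suc]) auto
  then have "\<forall>\<^sub>F n in sequentially. x * real (Suc n) powr (R - 1) < 1 / 2"
    by (rule order_tendstoD) simp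
  then obtain N where N: "\<And>n. n \<ge> N \<Longrightarrow> x * real (Suc n) powr (R - 1) < 1 / 2"
    unfolding eventually_sequentially by blast
  show ?thesis
  proof (rule summable_ratio_test[of "1 / 2" N])
    fix n assume "N \<le> n"
    then have "x * real (Suc n) powr (R - 1) * ?f n \<le> 1 / 2 * ?f n"
      using N[of n] x by (intro mult_right_mono) auto
    then show "norm (?f (Suc n)) \<le> 1 / 2 * norm (?f n)" unfolding step using x by simp
  qed simp
qed


section \<open>Series with multiples of the powers of a vector as components\<close>

context graded_lcs
begin

lemma seminormed_group_sym_power: "seminormed_group (sym_power n) (proj_seminorms n)"
proof
  have neg: "tensor_scale (- 1) x = - x" for x :: "('v, 'k) tensor" by (simp add: tensor.scale_minus_left)
  show "q (- x) = q x" if "q \<in> proj_seminorms n" "x \<in> sym_power n" for q x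
    using that proj_seminorm_scale[of _ x n "- 1"] sym_power_in_tensor_power by (auto simp: proj_seminorms_def neg)
  show "- x \<in> sym_power n" if "x \<in> sym_power n" for x using tensor.subspace_neg[OF sym_power_subspace that] .
qed (auto simp: proj_seminorms_def proj_seminorm_zero proj_seminorm_triangle sym_power_in_tensor_power
    intro: tensor.subspace_0 tensor.subspace_add sym_power_subspace)

lemma
  assumes x: "x \<in> sym_power n"
  shows sym_embed_in_hat: "sym_embed n x \<in> sym_power_hat n"
    and sym_embed_add: "y \<in> sym_power n \<Longrightarrow>
      completion_add (sym_power n) (proj_seminorms n) (sym_embed n x) (sym_embed n y) = sym_embed n (x + y)"
    and sym_embed_scale:
      "completion_map (sym_power n) (proj_seminorms n) (tensor_scale c) (sym_embed n x) = sym_embed n (tensor_scale c x)"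
    and sym_embed_seminorm: "continuous_seminorm p \<Longrightarrow>
      completion_seminorm (proj_seminorm p n) (sym_embed n x) = proj_seminorm p n x"
proof -
  interpret S: seminormed_group "sym_power n" "proj_seminorms n" by (rule seminormed_group_sym_power)
  show "sym_embed n x \<in> sym_power_hat n"
    unfolding sym_embed_def sym_power_hat_def by (rule S.completion_embed_in[OF x])
  show "completion_add (sym_power n) (proj_seminorms n) (sym_embed n x) (sym_embed n y) = sym_embed n (x + y)"
    if "y \<in> sym_power n"
    unfolding sym_embed_def by (rule S.completion_add_embed[OF x that])
  show "completion_seminorm (proj_seminorm p n) (sym_embed n x) = proj_seminorm p n x"
    if "continuous_seminorm p"
    unfolding sym_embed_def using that by (intro S.completion_seminorm_embed[OF x]) (auto simp: proj_seminorms_def)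
  show "completion_map (sym_power n) (proj_seminorms n) (tensor_scale c) (sym_embed n x) = sym_embed n (tensor_scale c x)"
    unfolding sym_embed_def
  proof (rule S.completion_map_embed[OF x, where K = "norm c"])
    fix q y assume "q \<in> proj_seminorms n" "y \<in> sym_power n"
    then show "q (tensor_scale c x - tensor_scale c y) \<le> norm c * q (x - y)"
      using proj_seminorm_scale[of _ "x - y" n c] S.diff_in[OF x] sym_power_in_tensor_power
      by (auto simp: proj_seminorms_def tensor.scale_right_diff_distrib)
  qed (auto intro: tensor.subspace_scale sym_power_subspace)
qed

definition coeff_series :: "'v \<Rightarrow> (nat \<Rightarrow> 'k) \<Rightarrow> nat \<Rightarrow> ('v, 'k) tensor filter set" where
  "coeff_series v c = (\<lambda>n. sym_embed n (tensor_scale (c n) (vpow v n)))"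

lemma scale_vpow_in_sym_power: "tensor_scale a (vpow v n) \<in> sym_power n"
  by (intro tensor.subspace_scale sym_power_subspace vpow_in_sym_power)

lemma exp_series_scale: "exp_series (scale t v) = coeff_series v (\<lambda>n. t ^ n / fact n)"
  by (simp add: exp_series_def coeff_series_def vpow_scale)

lemma series_zero_coeff: "series_zero = coeff_series v (\<lambda>n. 0)"
  by (simp add: series_zero_def coeff_series_def)

lemma series_add_coeff: "series_add (coeff_series v c) (coeff_series v d) = coeff_series v (\<lambda>n. c n + d n)"
  by (simp add: series_add_def coeff_series_def sym_embed_add scale_vpow_in_sym_power tensor.scale_left_distrib)

lemma series_scale_coeff: "series_scale a (coeff_series v c) = coeff_series v (\<lambda>n. a * c n)"
  by (simp add: series_scale_def coeff_series_def sym_embed_scale scale_vpow_in_sym_power)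

lemma series_diff_coeff: "series_diff (coeff_series v c) (coeff_series v d) = coeff_series v (\<lambda>n. c n - d n)"
  by (simp add: series_diff_def series_scale_coeff series_add_coeff)

lemma partial_sum_coeff: "partial_sum (\<lambda>k. coeff_series v (c k)) N = coeff_series v (\<lambda>n. \<Sum>k<N. c k n)"
  by (induction N) (simp_all add: series_zero_coeff series_add_coeff)

lemma series_seminorm_coeff:
  "continuous_seminorm p \<Longrightarrow> series_seminorm R p (coeff_series v c) =
    (\<Sum>n. ennreal (norm (c n) * proj_seminorm p n (vpow v n) * fact n powr R))"
  by (simp add: series_seminorm_def coeff_series_def sym_embed_seminorm scale_vpow_in_sym_power
      proj_seminorm_scale vpow_in_tensor_power)

text \<open>For \<open>x \<ge> 0\<close> this is the value of \<open>p\<^sub>R\<close> on \<open>exp (x v)\<close>.\<close>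

definition exp_majorant :: "real \<Rightarrow> ('v \<Rightarrow> real) \<Rightarrow> 'v \<Rightarrow> real \<Rightarrow> real" where
  "exp_majorant R p v x = (\<Sum>n. x ^ n / fact n * (proj_seminorm p n (vpow v n) * fact n powr R))"

text \<open>
  The bound \<open>p\<^sup>n(v\<^sup>n) \<le> q\<^sup>n\<close> only rescales \<open>x\<close>; convergence then comes from the factor \<open>n!\<^sup>R / n!\<close>.
\<close>

lemma exp_majorant_sums:
  assumes R: "R < 1" and p: "continuous_seminorm p" and x: "0 \<le> x"
  shows "(\<lambda>n. x ^ n / fact n * (proj_seminorm p n (vpow v n) * fact n powr R)) sums exp_majorant R p v x"
  unfolding exp_majorant_def
proof (rule summable_sums, rule summable_comparison_test'[of _ 0])
  let ?q = "graded_seminorm p v"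
  have q: "0 \<le> ?q" using continuous_seminorm_nonneg[OF continuous_graded_seminorm[OF p]] .
  show "summable (\<lambda>n. (x * ?q) ^ n / fact n * fact n powr R)"
    using R x q by (intro summable_power_fact_powr) auto
  fix n
  have "x ^ n / fact n * (proj_seminorm p n (vpow v n) * fact n powr R) \<le> x ^ n / fact n * (?q ^ n * fact n powr R)"
    using x by (intro mult_left_mono mult_right_mono proj_seminorm_vpow_le[OF p]) auto
  then show "norm (x ^ n / fact n * (proj_seminorm p n (vpow v n) * fact n powr R)) \<le> (x * ?q) ^ n / fact n * fact n powr R"
    using x proj_seminorm_nonneg[OF p vpow_in_tensor_power] by (simp add: power_mult_distrib abs_mult)
qed

lemma exp_majorant_nonneg:
  assumes "R < 1" and p: "continuous_seminorm p" and "0 \<le> x"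
  shows "0 \<le> exp_majorant R p v x"
  by (rule sums_le[OF _ sums_zero exp_majorant_sums[OF assms]])
    (use proj_seminorm_nonneg[OF p vpow_in_tensor_power] \<open>0 \<le> x\<close> in simp)

text \<open>
  All convergence statements below reduce to this estimate: it suffices to compare coefficients
  with those of \<open>K exp x\<close>.
\<close>

lemma series_seminorm_coeff_le:
  assumes R: "R < 1" and p: "continuous_seminorm p" and x: "0 \<le> x" and K: "0 \<le> K"
    and c: "\<And>n. norm (c n) \<le> K * (x ^ n / fact n)"
  shows "series_seminorm R p (coeff_series v c) \<le> ennreal (K * exp_majorant R p v x)"
proof -
  let ?w = "\<lambda>n. proj_seminorm p n (vpow v n) * fact n powr R"
  have w: "0 \<le> ?w n" for n using proj_seminorm_nonneg[OF p vpow_in_tensor_power] by simp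
  have sums: "(\<lambda>n. K * (x ^ n / fact n * ?w n)) sums (K * exp_majorant R p v x)"
    by (intro sums_mult exp_majorant_sums R p x)
  have "series_seminorm R p (coeff_series v c) \<le> (\<Sum>n. ennreal (K * (x ^ n / fact n * ?w n)))"
    unfolding series_seminorm_coeff[OF p]
  proof (intro suminf_le ennreal_leI summableI)
    fix n show "norm (c n) * proj_seminorm p n (vpow v n) * fact n powr R \<le> K * (x ^ n / fact n * ?w n)"
      using mult_right_mono[OF c w] by (simp add: mult_ac)
  qed
  also have "\<dots> = ennreal (\<Sum>n. K * (x ^ n / fact n * ?w n))"
    by (rule suminf_ennreal2) (use K x w sums in \<open>auto simp: sums_iff intro!: mult_nonneg_nonneg\<close>)
  also have "\<dots> = ennreal (K * exp_majorant R p v x)" using sums by (simp add: sums_iff)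
  finally show ?thesis .
qed

lemma coeff_series_in_W_hat:
  assumes "R < 1" "0 \<le> x" "0 \<le> K" "\<And>n. norm (c n) \<le> K * (x ^ n / fact n)"
  shows "coeff_series v c \<in> W_hat R"
proof -
  have "coeff_series v c n \<in> sym_power_hat n" for n
    unfolding coeff_series_def by (intro sym_embed_in_hat scale_vpow_in_sym_power)
  moreover have "series_seminorm R p (coeff_series v c) < \<infinity>" if "continuous_seminorm p" for p
    using series_seminorm_coeff_le[OF assms(1) that assms(2-4)] by (rule order_le_less_trans) simp
  ultimately show ?thesis by (simp add: W_hat_def)
qed

lemma W_tendsto_coeff:
  assumes R: "R < 1" and x: "0 \<le> x" and K: "\<And>z. 0 \<le> K z" "(K \<longlongrightarrow> 0) F"
    and c: "\<forall>\<^sub>F z in F. \<forall>n. norm (c z n - d n) \<le> K z * (x ^ n / fact n)"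
  shows "W_tendsto R (\<lambda>z. coeff_series v (c z)) (coeff_series v d) F"
  unfolding W_tendsto_def series_diff_coeff
proof (intro allI impI)
  fix p assume p: "continuous_seminorm p"
  have "((\<lambda>z. ennreal (K z * exp_majorant R p v x)) \<longlongrightarrow> ennreal (0 * exp_majorant R p v x)) F"
    by (intro tendsto_ennrealI tendsto_mult K tendsto_const)
  then have lim: "((\<lambda>z. ennreal (K z * exp_majorant R p v x)) \<longlongrightarrow> 0) F" by simp
  have le: "\<forall>\<^sub>F z in F. series_seminorm R p (coeff_series v (\<lambda>n. c z n - d n)) \<le> ennreal (K z * exp_majorant R p v x)"
    using c by eventually_elim (intro series_seminorm_coeff_le R p x K, auto)
  show "((\<lambda>z. series_seminorm R p (coeff_series v (\<lambda>n. c z n - d n))) \<longlongrightarrow> 0) F"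
    by (rule tendsto_sandwich[OF _ le tendsto_const lim]) simp
qed


section \<open>Derivatives and Taylor series of the exponential\<close>

text \<open>
  The \<open>k\<close>-th derivative of \<open>t\<^sup>n / n!\<close>; the binomial coefficient makes it vanish for \<open>k > n\<close>.
\<close>

definition taylor_coeff :: "nat \<Rightarrow> 'k \<Rightarrow> nat \<Rightarrow> 'k" where
  "taylor_coeff k t n = fact k * (of_nat (n choose k) * t ^ (n - k)) / fact n"

lemma taylor_coeff_le: "norm (taylor_coeff k t n) \<le> fact k * ((1 + norm t) ^ n / fact n)"
proof -
  have "of_nat (n choose k) * norm t ^ (n - k) \<le> (1 + norm t) ^ n"
    using binomial_term_le[of 1 "norm t" n k] by simp
  then have "fact k * (of_nat (n choose k) * norm t ^ (n - k)) / fact n \<le> fact k * (1 + norm t) ^ n / fact n"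
    by (intro divide_right_mono mult_left_mono) auto
  then show ?thesis by (simp add: taylor_coeff_def norm_mult norm_divide norm_power norm_fact)
qed

lemma taylor_term: "s ^ k / fact k * taylor_coeff k t n = of_nat (n choose k) * s ^ k * t ^ (n - k) / fact n"
  by (simp add: taylor_coeff_def)

lemma taylor_term_le:
  "norm (s ^ k / fact k * taylor_coeff k t n) \<le> (1 / 2) ^ k * ((2 * norm s + norm t) ^ n / fact n)"
proof -
  have "of_nat (n choose k) * norm s ^ k * norm t ^ (n - k)
      = (1 / 2) ^ k * (of_nat (n choose k) * (2 * norm s) ^ k * norm t ^ (n - k))"
    by (simp add: power_mult_distrib power_divide)
  also have "\<dots> \<le> (1 / 2) ^ k * (2 * norm s + norm t) ^ n"
    by (intro mult_left_mono binomial_term_le) auto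
  finally have "of_nat (n choose k) * norm s ^ k * norm t ^ (n - k) / fact n \<le> (1 / 2) ^ k * (2 * norm s + norm t) ^ n / fact n"
    by (rule divide_right_mono) simp
  then show ?thesis unfolding taylor_term by (simp add: norm_mult norm_divide norm_power norm_fact)
qed

lemma taylor_coeff_in_W_hat: "R < 1 \<Longrightarrow> coeff_series v (taylor_coeff k t) \<in> W_hat R"
  by (rule coeff_series_in_W_hat[OF _ _ _ taylor_coeff_le]) auto

lemma taylor_coeff_difference_quotient:
  assumes h: "norm h \<le> 1" "h \<noteq> 0"
  shows "norm (1 / h * (taylor_coeff k (t + h) n - taylor_coeff k t n) - taylor_coeff (Suc k) t n)
    \<le> norm h * fact k * ((2 + norm t) ^ n / fact n)"
proof -
  let ?m = "n - k" and ?b = "of_nat (n choose k) :: 'k"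
  have "Suc k * (n choose Suc k) = ?m * (n choose k)"
    by (simp only: binomial_absorption binomial_absorb_comp)
  then have "of_nat (Suc k) * of_nat (n choose Suc k) = (of_nat ?m * ?b :: 'k)"
    by (simp only: of_nat_mult[symmetric])
  then have d: "taylor_coeff (Suc k) t n = fact k * ?b / fact n * (of_nat ?m * t ^ (?m - 1))"
    by (simp add: taylor_coeff_def mult_ac del: of_nat_Suc)
  have "1 / h * (taylor_coeff k (t + h) n - taylor_coeff k t n) - taylor_coeff (Suc k) t n
      = fact k * ?b / fact n * (((t + h) ^ ?m - t ^ ?m) / h - of_nat ?m * t ^ (?m - 1))"
    unfolding d by (simp add: taylor_coeff_def diff_divide_distrib right_diff_distrib mult_ac)
  also have "norm \<dots> = fact k * of_nat (n choose k) / fact n * norm (((t + h) ^ ?m - t ^ ?m) / h - of_nat ?m * t ^ (?m - 1))"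
    by (simp only: norm_mult norm_divide norm_fact norm_of_nat)
  also have "\<dots> \<le> fact k * of_nat (n choose k) / fact n * (norm h * (norm t + 1) ^ ?m)"
    by (intro mult_left_mono difference_quotient_power_le h) auto
  also have "\<dots> = norm h * fact k / fact n * (of_nat (n choose k) * 1 ^ k * (norm t + 1) ^ ?m)" by simp
  also have "\<dots> \<le> norm h * fact k / fact n * (1 + (norm t + 1)) ^ n"
    by (intro mult_left_mono binomial_term_le) auto
  finally show ?thesis by (simp add: add_ac)
qed

lemma taylor_coeff_has_derivative:
  assumes "R < 1"
  shows "W_has_derivative R (\<lambda>t. coeff_series v (taylor_coeff k t)) (coeff_series v (taylor_coeff (Suc k) t)) t"
  unfolding W_has_derivative_def series_diff_coeff series_scale_coeff
proof (rule W_tendsto_coeff[OF assms, where x = "2 + norm t" and K = "\<lambda>h. norm h * fact k"])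
  have "((\<lambda>h::'k. norm h * fact k) \<longlongrightarrow> norm (0::'k) * fact k) (at 0)" by (intro tendsto_intros)
  then show "((\<lambda>h::'k. norm h * fact k) \<longlongrightarrow> 0) (at 0)" by simp
  have "\<forall>\<^sub>F h::'k in at 0. h \<noteq> 0 \<and> norm h \<le> 1"
    unfolding eventually_at by (intro exI[of _ 1]) auto
  then show "\<forall>\<^sub>F h in at 0. \<forall>n. norm (1 / h * (taylor_coeff k (t + h) n - taylor_coeff k t n) - taylor_coeff (Suc k) t n)
      \<le> norm h * fact k * ((2 + norm t) ^ n / fact n)"
    by (rule eventually_mono) (intro allI taylor_coeff_difference_quotient, auto)
qed auto

lemma taylor_abs_summable:
  assumes R: "R < 1"
  shows "W_abs_summable R (\<lambda>k. series_scale (s ^ k / fact k) (coeff_series v (taylor_coeff k t)))"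
  unfolding W_abs_summable_def
proof (intro allI impI)
  fix p assume p: "continuous_seminorm p"
  let ?M = "exp_majorant R p v (2 * norm s + norm t)"
  have M: "0 \<le> ?M" using R p by (rule exp_majorant_nonneg) simp
  have "(\<Sum>k. series_seminorm R p (series_scale (s ^ k / fact k) (coeff_series v (taylor_coeff k t))))
      \<le> (\<Sum>k. ennreal ((1 / 2) ^ k * ?M))"
    unfolding series_scale_coeff
    by (intro suminf_le summableI series_seminorm_coeff_le[OF R p _ _ taylor_term_le]) auto
  also have "\<dots> = ennreal (\<Sum>k. (1 / 2) ^ k * ?M)"
    by (intro suminf_ennreal2 summable_mult2 summable_geometric) (use M in auto)
  finally show "(\<Sum>k. series_seminorm R p (series_scale (s ^ k / fact k) (coeff_series v (taylor_coeff k t)))) < \<infinity>"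
    by (rule order_le_less_trans) simp
qed

lemma taylor_sums:
  assumes R: "R < 1"
  shows "W_sums R (\<lambda>k. series_scale ((t - t0) ^ k / fact k) (coeff_series v (taylor_coeff k t0)))
    (coeff_series v (taylor_coeff 0 t))"
  unfolding W_sums_def series_scale_coeff partial_sum_coeff
proof (rule W_tendsto_coeff[OF R, where x = "2 * norm (t - t0) + norm t0" and K = "\<lambda>N. (1 / 2) ^ N"])
  show "(\<lambda>N. (1 / 2 :: real) ^ N) \<longlonglongrightarrow> 0" by (rule LIMSEQ_power_zero) simp
  have "norm ((\<Sum>k<N. (t - t0) ^ k / fact k * taylor_coeff k t0 n) - taylor_coeff 0 t n)
      \<le> (1 / 2) ^ N * ((2 * norm (t - t0) + norm t0) ^ n / fact n)" for N n
  proof -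
    have "(\<Sum>k<N. (t - t0) ^ k / fact k * taylor_coeff k t0 n) - taylor_coeff 0 t n
        = ((\<Sum>k<N. of_nat (n choose k) * (t - t0) ^ k * t0 ^ (n - k)) - ((t - t0) + t0) ^ n) / fact n"
      unfolding taylor_term by (simp add: sum_divide_distrib diff_divide_distrib taylor_coeff_def)
    then show ?thesis
      using divide_right_mono[OF binomial_tail_le[where a = "t - t0" and b = t0 and n = n and N = N], of "fact n"]
      by (simp only: norm_divide norm_fact) simp
  qed
  then show "\<forall>\<^sub>F N in sequentially. \<forall>n. norm ((\<Sum>k<N. (t - t0) ^ k / fact k * taylor_coeff k t0 n) - taylor_coeff 0 t n)
      \<le> (1 / 2) ^ N * ((2 * norm (t - t0) + norm t0) ^ n / fact n)" by simp
qed auto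

lemma exp_series_taylor_coeff: "exp_series (scale t v) = coeff_series v (taylor_coeff 0 t)"
  by (simp add: exp_series_scale taylor_coeff_def[abs_def])

lemma exp_series_in_W_hat: "R < 1 \<Longrightarrow> exp_series (scale t v) \<in> W_hat R"
  unfolding exp_series_taylor_coeff by (rule taylor_coeff_in_W_hat)

lemma exp_series_taylor_converges:
  "R < 1 \<Longrightarrow> W_taylor_converges_absolutely R (\<lambda>t. exp_series (scale t v))"
  unfolding W_taylor_converges_absolutely_def
  by (rule exI[of _ "\<lambda>k t. coeff_series v (taylor_coeff k t)"])
    (auto simp: exp_series_taylor_coeff taylor_coeff_in_W_hat taylor_coeff_has_derivative
      taylor_abs_summable taylor_sums)

lemma exp_series_analytic: "R < 1 \<Longrightarrow> W_analytic_infinite_radius R (\<lambda>t. exp_series (scale t v))"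
  unfolding W_analytic_infinite_radius_def
proof (rule allI)
  fix t0 assume R: "R < 1"
  have le: "norm (1 / fact k * taylor_coeff k t0 n) \<le> 1 * ((1 + norm t0) ^ n / fact n)" for k n
    using mult_left_mono[OF taylor_coeff_le[of k t0 n], of "1 / fact k"]
    by (simp add: norm_mult norm_divide norm_fact)
  show "\<exists>a. (\<forall>k. a k \<in> W_hat R) \<and>
      (\<forall>t. W_sums R (\<lambda>k. series_scale ((t - t0) ^ k) (a k)) (exp_series (scale t v)))"
  proof (intro exI[of _ "\<lambda>k. coeff_series v (\<lambda>n. 1 / fact k * taylor_coeff k t0 n)"] conjI allI)
    show "coeff_series v (\<lambda>n. 1 / fact k * taylor_coeff k t0 n) \<in> W_hat R" for k
      by (rule coeff_series_in_W_hat[OF R _ _ le]) auto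
    show "W_sums R (\<lambda>k. series_scale ((t - t0) ^ k) (coeff_series v (\<lambda>n. 1 / fact k * taylor_coeff k t0 n)))
        (exp_series (scale t v))" for t
      using taylor_sums[OF R, of t t0 v] by (simp add: series_scale_coeff exp_series_taylor_coeff)
  qed
qed

lemma exp_series_entire: "R < 1 \<Longrightarrow> W_entire R (\<lambda>t. exp_series (scale t v))"
  unfolding W_entire_def exp_series_taylor_coeff
  using taylor_coeff_in_W_hat taylor_coeff_has_derivative by blast

text \<open>
  Normalizing \<open>\<phi> w = 1\<close> for an even vector \<open>w\<close>, the seminorm \<open>\<bar>\<phi>\<bar>\<close> gives \<open>w\<^sup>n\<close> size at least 1, so
  the \<open>n\<close>-th term of the series of seminorms is at least \<open>n!\<^sup>R\<^sup>-\<^sup>1 \<ge> 1\<close>.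
\<close>

lemma exp_series_not_in_W_hat:
  assumes \<phi>: "Vector_Spaces.linear scale (*) \<phi>" "continuous_on UNIV \<phi>" "\<phi> v \<noteq> 0"
    and v: "v \<in> V0" and R: "1 \<le> R"
  shows "\<exists>w. w \<noteq> 0 \<and> exp_series w \<notin> W_hat R"
proof (intro exI conjI notI)
  let ?w = "scale (1 / \<phi> v) v" and ?p = "\<lambda>x. norm (\<phi> x)"
  have lin: "\<phi> (x + y) = \<phi> x + \<phi> y" "\<phi> (scale c x) = c * \<phi> x" for x y c
    using \<phi>(1) by (auto simp: Vector_Spaces.linear_iff)
  have w: "?w \<in> V0" "\<phi> ?w = 1" using v subspace_scale[OF subspace_V0] \<phi>(3) by (auto simp: lin)
  show False if "?w = 0" using that w(2) lin(2)[of 0 0] by (metis mult_zero_left scale_zero_left zero_neq_one)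
  assume "exp_series ?w \<in> W_hat R"
  moreover have p: "continuous_seminorm ?p"
    unfolding continuous_seminorm_def
    using \<phi>(2) by (auto simp: lin norm_mult norm_triangle_ineq intro: continuous_on_norm)
  ultimately have fin: "series_seminorm R ?p (exp_series ?w) < \<infinity>" by (simp add: W_hat_def)
  let ?a = "\<lambda>n. norm (1 / fact n :: 'k) * proj_seminorm ?p n (vpow ?w n) * fact n powr R"
  have "series_seminorm R ?p (exp_series ?w) = (\<Sum>n. ennreal (?a n))"
    using series_seminorm_coeff[OF p, of R ?w "\<lambda>n. 1 / fact n"]
    by (simp add: exp_series_def coeff_series_def)
  with fin obtain N where N: "(\<Sum>n. ennreal (?a n)) < of_nat N"
    using ennreal_Ex_less_of_nat by (metis infinity_ennreal_def)
  have "1 \<le> ?a n" for n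
  proof -
    have "1 \<le> proj_seminorm ?p n (vpow ?w n)"
      using proj_seminorm_replicate_ge[OF \<phi>(1), of ?w n] w by (simp add: vpow_even)
    moreover have "fact n powr 1 \<le> (fact n :: real) powr R" using R by (intro powr_mono) auto
    ultimately have "fact n * 1 \<le> fact n powr R * proj_seminorm ?p n (vpow ?w n)"
      by (intro mult_mono) auto
    then show ?thesis by (simp add: norm_divide norm_fact field_simps)
  qed
  then have "(\<Sum>n<N. 1) \<le> (\<Sum>n<N. ennreal (?a n))" by (intro sum_mono) (simp add: ennreal_ge_1)
  also have "\<dots> \<le> (\<Sum>n. ennreal (?a n))" by (rule sum_le_suminf) auto
  finally show False using N by simp
qed

text \<open>
  Hahn-Banach enters as a hypothesis because the passage from a real-linear to a \<open>K\<close>-linear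
  functional depends on the ground field.
\<close>

lemma exp_series_in_W_hat_iff:
  assumes functional: "\<And>v. v \<noteq> 0 \<Longrightarrow> \<exists>\<phi>. Vector_Spaces.linear scale (*) \<phi> \<and> continuous_on UNIV \<phi> \<and> \<phi> v \<noteq> 0"
    and V0: "V0 \<noteq> {0}"
  shows "(\<forall>v. v \<noteq> 0 \<longrightarrow> exp_series v \<in> W_hat R) \<longleftrightarrow> R < 1"
proof
  assume all: "\<forall>v. v \<noteq> 0 \<longrightarrow> exp_series v \<in> W_hat R"
  obtain v where "v \<in> V0" "v \<noteq> 0" using V0 subspace_0[OF subspace_V0] by blast
  then show "R < 1" using functional exp_series_not_in_W_hat all by (meson not_le)
next
  assume "R < 1"
  then show "\<forall>v. v \<noteq> 0 \<longrightarrow> exp_series v \<in> W_hat R" using exp_series_in_W_hat[of R 1] by simp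
qed

end


section \<open>Real and complex scalars\<close>

theorem proposition3p19:
  fixes R :: real
    and sR :: "real \<Rightarrow> 'v::{t2_space, topological_ab_group_add} \<Rightarrow> 'v"
    and sC :: "complex \<Rightarrow> 'w::{t2_space, topological_ab_group_add} \<Rightarrow> 'w"
    and V0 V1 :: "'v set"
    and W0 W1 :: "'w set"
  shows
    "(graded_lcs sR V0 V1 \<and> V0 \<noteq> {0} \<longrightarrow>
        ((\<forall>v. v \<noteq> 0 \<longrightarrow> graded_lcs.exp_series sR V0 V1 v
                          \<in> graded_lcs.W_hat sR V0 V1 R) \<longleftrightarrow> R < 1) \<and>
        (R < 1 \<longrightarrow> (\<forall>v.
           let f = (\<lambda>t. graded_lcs.exp_series sR V0 V1 (sR t v)) in
             (\<forall>t. f t \<in> graded_lcs.W_hat sR V0 V1 R) \<and>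
             graded_lcs.W_analytic_infinite_radius sR V0 V1 R f \<and>
             graded_lcs.W_taylor_converges_absolutely sR V0 V1 R f)))
     \<and>
     (graded_lcs sC W0 W1 \<and> W0 \<noteq> {0} \<longrightarrow>
        ((\<forall>v. v \<noteq> 0 \<longrightarrow> graded_lcs.exp_series sC W0 W1 v
                          \<in> graded_lcs.W_hat sC W0 W1 R) \<longleftrightarrow> R < 1) \<and>
        (R < 1 \<longrightarrow> (\<forall>v.
           let f = (\<lambda>t. graded_lcs.exp_series sC W0 W1 (sC t v)) in
             (\<forall>t. f t \<in> graded_lcs.W_hat sC W0 W1 R) \<and>
             graded_lcs.W_entire sC W0 W1 R f \<and>
             graded_lcs.W_taylor_converges_absolutely sC W0 W1 R f)))"
proof (intro conjI impI)
  assume A: "graded_lcs sR V0 V1 \<and> V0 \<noteq> {0}"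
  then interpret graded_lcs sR V0 V1 by blast
  show "(\<forall>v. v \<noteq> 0 \<longrightarrow> exp_series v \<in> W_hat R) \<longleftrightarrow> R < 1"
    using A real_functional by (intro exp_series_in_W_hat_iff) blast+
  show "\<forall>v. let f = (\<lambda>t. exp_series (sR t v)) in (\<forall>t. f t \<in> W_hat R) \<and>
      W_analytic_infinite_radius R f \<and> W_taylor_converges_absolutely R f" if "R < 1"
    using that by (simp add: Let_def exp_series_in_W_hat exp_series_analytic exp_series_taylor_converges)
next
  assume A: "graded_lcs sC W0 W1 \<and> W0 \<noteq> {0}"
  then interpret graded_lcs sC W0 W1 by blast
  show "(\<forall>v. v \<noteq> 0 \<longrightarrow> exp_series v \<in> W_hat R) \<longleftrightarrow> R < 1"
    using A complex_functional by (intro exp_series_in_W_hat_iff) blast+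
  show "\<forall>v. let f = (\<lambda>t. exp_series (sC t v)) in (\<forall>t. f t \<in> W_hat R) \<and>
      W_entire R f \<and> W_taylor_converges_absolutely R f" if "R < 1"
    using that by (simp add: Let_def exp_series_in_W_hat exp_series_entire exp_series_taylor_converges)
qed

end
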